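(* For $\varrho\ge1$ and integers $n\ge2$ define $$\mu_n^-(\varrho):=-1-\frac{n\,\varrho^{(n-1)^2}\left(1-\left(1-\frac1n\right)\varrho^{2n-1}\right)}{2n-1},$$ and denote by $\nu_n^*$ the unique root of $\mu_n^-$ in the interval $[1,+\infty)$. Then for any $n\ge2$ and with $s=n^2$, the maximum internal amplification factor of the optimal $s$-stage third order SSP Runge--Kutta method satisfies $$\mathcal{M}_s^{\mathrm{SSP3}}=(\nu_n^* )^{(n^2-n)/2}.$$ For any $n\ge9$ (and $s=n^2$), $$\frac9{10}\sqrt{\frac n{\ln n}}<\left(1+\frac{\ln n}{n^2}-\frac{\ln(\ln n)}{n^2}\right)^{(n^2-n)/2}<\mathcal{M}_s^{\mathrm{SSP3}}<\left(1+\frac{\ln n}{n^2}-\frac{\ln(\ln n)}{8n^2}\right)^{(n^2-n)/2}<\frac{\sqrt n}{\sqrt[16]{\ln n}}.$$ For $n=2,3,4,5,6,7,8,9,10$ the values of $\mathcal{M}_{n^2}^{\mathrm{SSP3}}$, rounded up to three decimals, are respectively $1.575,\ 1.794,\ 1.956,\ 2.091,\ 2.209,\ 2.314,\ 2.411,\ 2.501,\ 2.585$.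
   Context: For $n\ge2$, $s=n^2$, $k_n=\frac{n(n+1)}2+1$, $m_n=\frac{(n-1)(n-2)}2+1$, the optimal $s$-stage third order SSP Runge--Kutta method, implemented in the following form, is $$Y_1=U_n,\qquad Y_j=Y_{j-1}+\frac{\tau}{n^2-n}F(Y_{j-1})\quad(2\le j\le s,\ j\ne k_n),$$ $$Y_{k_n}=\frac{n-1}{2n-1}Y_{k_n-1}+\frac{n}{2n-1}Y_{m_n}+\frac{\tau}{n(2n-1)}F(Y_{k_n-1}),\qquad U_{n+1}=Y_{s+1}=Y_s+\frac{\tau}{n^2-n}F(Y_s)$$ (in $U_n,U_{n+1}$ the subscript is the time-step index). This is of Shu--Osher form $Y_i=v_iU_n+\sum_{j=1}^s(\alpha_{ij}Y_j+\tau\beta_{ij}F(Y_j))$, $1\le i\le s+1$, $U_{n+1}=Y_{s+1}$, with $v_1=1$ and $v_i=0$ for $i\ge2$. Write $\alpha_{1:s},\beta_{1:s}$ for the upper-left $s\times s$ blocks, $\alpha_{s+1},\beta_{s+1}$ for the first $s$ entries of the last rows, and $v_{1:s}=(v_1,\dots,v_s)^\top$. The stability function is $P(z)=v_{s+1}+(\alpha_{s+1}+z\beta_{s+1})(I_s-\alpha_{1:s}-z\beta_{1:s})^{-1}v_{1:s}$ and the internal stability functions are $(Q_1(z),\dots,Q_s(z))=(\alpha_{s+1}+z\beta_{s+1})(I_s-\alpha_{1:s}-z\beta_{1:s})^{-1}$. The maximum internal amplification factor is $\max_{1\le j\le s}\sup_{z\in\mathcal{S}}|Q_j(z)|$, where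 $\mathcal{S}=\{z\in\mathbb{C}:|P(z)|\le1\}$ is the absolute stability region; for the optimal $s$-stage third order SSP Runge--Kutta method with $s=n^2$, implemented in the form $Y_1=U_n$, $Y_j=Y_{j-1}+\frac{\tau}{n^2-n}F(Y_{j-1})$ $(2\le j\le s,\ j\ne k_n)$, $Y_{k_n}=\frac{n-1}{2n-1}Y_{k_n-1}+\frac{n}{2n-1}Y_{m_n}+\frac{\tau}{n(2n-1)}F(Y_{k_n-1})$, $U_{n+1}=Y_{s+1}=Y_s+\frac{\tau}{n^2-n}F(Y_s)$, it is denoted $\mathcal{M}_s^{\mathrm{SSP3}}$. *)

theory Defs
  imports
    Complex_Main
    "HOL-Library.Extended_Real"
    "Jordan_Normal_Form.Gauss_Jordan_Elimination"
    "Jordan_Normal_Form.Determinant"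
begin

text \<open>
  Coefficients \<open>v\<^sub>i\<close>, \<open>\<alpha>\<^sub>i\<^sub>j\<close>, \<open>\<beta>\<^sub>i\<^sub>j\<close> of a Runge--Kutta method with \<open>s\<close> stages in Shu--Osher form,
  indexed from 1 with \<open>1 \<le> i \<le> s + 1\<close> and \<open>1 \<le> j \<le> s\<close>.  Values outside these ranges are never used.
\<close>

record shu_osher =
  num_stages :: nat
  v_coeff :: "nat \<Rightarrow> real"
  alpha_coeff :: "nat \<Rightarrow> nat \<Rightarrow> real"
  beta_coeff :: "nat \<Rightarrow> nat \<Rightarrow> real"

text \<open>\<open>Y\<close> holds the stage values and the new step value \<open>Y (s + 1)\<close> of one step from \<open>U\<close>.\<close>

definition shu_osher_step ::
  "shu_osher \<Rightarrow> ('a::real_vector \<Rightarrow> 'a) \<Rightarrow> real \<Rightarrow> 'a \<Rightarrow> (nat \<Rightarrow> 'a) \<Rightarrow> bool" where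
  "shu_osher_step M F \<tau> U Y \<longleftrightarrow>
     (\<forall>i\<in>{1..num_stages M + 1}.
        Y i = v_coeff M i *\<^sub>R U
          + (\<Sum>j=1..num_stages M. alpha_coeff M i j *\<^sub>R Y j + (\<tau> * beta_coeff M i j) *\<^sub>R F (Y j)))"


text \<open>Matrix and vector positions below are counted from 0, coefficient indices from 1.\<close>

definition v_vec :: "shu_osher \<Rightarrow> complex vec" where
  "v_vec M = vec (num_stages M) (\<lambda>i. of_real (v_coeff M (i + 1)))"

definition alpha_mat :: "shu_osher \<Rightarrow> complex mat" where
  "alpha_mat M = mat (num_stages M) (num_stages M) (\<lambda>(i, j). of_real (alpha_coeff M (i + 1) (j + 1)))"

definition beta_mat :: "shu_osher \<Rightarrow> complex mat" where
  "beta_mat M = mat (num_stages M) (num_stages M) (\<lambda>(i, j). of_real (beta_coeff M (i + 1) (j + 1)))"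

definition alpha_last :: "shu_osher \<Rightarrow> complex vec" where
  "alpha_last M = vec (num_stages M) (\<lambda>j. of_real (alpha_coeff M (num_stages M + 1) (j + 1)))"

definition beta_last :: "shu_osher \<Rightarrow> complex vec" where
  "beta_last M = vec (num_stages M) (\<lambda>j. of_real (beta_coeff M (num_stages M + 1) (j + 1)))"

definition stage_mat :: "shu_osher \<Rightarrow> complex \<Rightarrow> complex mat" where
  "stage_mat M z = 1\<^sub>m (num_stages M) - alpha_mat M - z \<cdot>\<^sub>m beta_mat M"

text \<open>
  The row vector \<open>r B\<close> is written as \<open>B\<^sup>T r\<close>.  The inverse exists for explicit methods, see
  \<open>mat_inverse_stage_mat\<close> below.
\<close>

definition internal_stability_vec :: "shu_osher \<Rightarrow> complex \<Rightarrow> complex vec" where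
  "internal_stability_vec M z =
     transpose_mat (the (mat_inverse (stage_mat M z))) *\<^sub>v (alpha_last M + z \<cdot>\<^sub>v beta_last M)"

definition internal_stability_fun :: "shu_osher \<Rightarrow> nat \<Rightarrow> complex \<Rightarrow> complex" where
  "internal_stability_fun M j z = internal_stability_vec M z $ (j - 1)"

definition stability_fun :: "shu_osher \<Rightarrow> complex \<Rightarrow> complex" where
  "stability_fun M z =
     of_real (v_coeff M (num_stages M + 1)) + internal_stability_vec M z \<bullet> v_vec M"

definition stability_region :: "shu_osher \<Rightarrow> complex set" where
  "stability_region M = {z. cmod (stability_fun M z) \<le> 1}"

text \<open>Taken in the extended reals, so that the supremum is meaningful without a boundedness proof.\<close>

definition max_internal_amplification :: "shu_osher \<Rightarrow> ereal" where
  "max_internal_amplification M =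
     (MAX j\<in>{1..num_stages M}. SUP z\<in>stability_region M. ereal (cmod (internal_stability_fun M j z)))"


definition ssp3_k :: "nat \<Rightarrow> nat" where
  "ssp3_k n = n * (n + 1) div 2 + 1"

definition ssp3_m :: "nat \<Rightarrow> nat" where
  "ssp3_m n = (n - 1) * (n - 2) div 2 + 1"

definition ssp3 :: "nat \<Rightarrow> shu_osher" where
  "ssp3 n = \<lparr>
     num_stages = n^2,
     v_coeff = (\<lambda>i. if i = 1 then 1 else 0),
     alpha_coeff = (\<lambda>i j.
       if i = ssp3_k n then
         (if j = i - 1 then (real n - 1) / (2 * real n - 1)
          else if j = ssp3_m n then real n / (2 * real n - 1)
          else 0)
       else if 2 \<le> i \<and> j = i - 1 then 1 else 0),
     beta_coeff = (\<lambda>i j.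
       if 2 \<le> i \<and> j = i - 1 then
         (if i = ssp3_k n then 1 / (real n * (2 * real n - 1)) else 1 / (real n ^ 2 - real n))
       else 0)\<rparr>"

text \<open>\<open>ssp3_amplification n\<close> is the quantity for \<open>s = n\<^sup>2\<close> stages.\<close>

definition ssp3_amplification :: "nat \<Rightarrow> ereal" where
  "ssp3_amplification n = max_internal_amplification (ssp3 n)"

definition mu_minus :: "nat \<Rightarrow> real \<Rightarrow> real" where
  "mu_minus n \<rho> =
     - 1 - real n * \<rho> ^ ((n - 1)^2) * (1 - (1 - 1 / real n) * \<rho> ^ (2 * n - 1)) / (2 * real n - 1)"

definition nu_star :: "nat \<Rightarrow> real" where
  "nu_star n = (THE \<rho>. 1 \<le> \<rho> \<and> mu_minus n \<rho> = 0)"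

definition rounded_up :: "nat \<Rightarrow> real \<Rightarrow> real" where
  "rounded_up d x = real_of_int \<lceil>10 ^ d * x\<rceil> / 10 ^ d"


lemma mat_inverse_stage_mat:
  assumes expl: "\<And>i j. 1 \<le> i \<Longrightarrow> i \<le> j \<Longrightarrow> j \<le> num_stages M \<Longrightarrow>
                   alpha_coeff M i j = 0 \<and> beta_coeff M i j = 0"
  obtains B where "mat_inverse (stage_mat M z) = Some B"
    "B \<in> carrier_mat (num_stages M) (num_stages M)"
    "inverts_mat (stage_mat M z) B" "inverts_mat B (stage_mat M z)"
proof -
  let ?s = "num_stages M" and ?A = "stage_mat M z"
  have A: "?A \<in> carrier_mat ?s ?s"
    by (auto simp: stage_mat_def alpha_mat_def beta_mat_def)
  have entry: "?A $$ (i, j) = (if i = j then 1 else 0)" if "i \<le> j" "j < ?s" for i j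
    using that expl[of "i + 1" "j + 1"]
    by (auto simp: stage_mat_def alpha_mat_def beta_mat_def)
  have "det ?A = prod_list (diag_mat ?A)"
    by (rule det_lower_triangular[OF _ A]) (use entry in auto)
  also have "\<dots> = 1"
    using A by (auto simp: prod_list_diag_prod entry)
  finally have "?A \<in> Units (ring_mat TYPE(complex) ?s ())"
    using A by (intro det_non_zero_imp_unit) auto
  with mat_inverse(1)[OF A, where b = "()"] obtain B where B: "mat_inverse ?A = Some B"
    by (cases "mat_inverse ?A") auto
  with mat_inverse(2)[OF A B] A show ?thesis
    by (intro that[of B]) (auto simp: inverts_mat_def)
qed

lemma ssp3_index_bounds:
  assumes "2 \<le> n"
  shows "1 \<le> ssp3_m n" "ssp3_m n + 2 \<le> ssp3_k n" "ssp3_k n \<le> n^2"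
proof -
  obtain p where n: "n = p + 2" using assms by (metis add.commute le_Suc_ex)
  have "p * (p + 1) + 2 \<le> n * (n + 1)" unfolding n by (simp add: algebra_simps)
  moreover have "(n - 1) * (n - 2) + 4 \<le> n * (n + 1)" unfolding n by (simp add: algebra_simps)
  moreover have "n * (n + 1) + 2 \<le> 2 * n^2" unfolding n by (simp add: power2_eq_square algebra_simps)
  ultimately show "1 \<le> ssp3_m n" "ssp3_m n + 2 \<le> ssp3_k n" "ssp3_k n \<le> n^2"
    by (auto simp: ssp3_m_def ssp3_k_def)
qed

lemma ssp3_explicit:
  assumes "2 \<le> n" "1 \<le> i" "i \<le> j"
  shows "alpha_coeff (ssp3 n) i j = 0 \<and> beta_coeff (ssp3 n) i j = 0"
  using ssp3_index_bounds[OF assms(1)] assms by (auto simp: ssp3_def)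

text \<open>The coefficients of \<open>ssp3\<close> reproduce the stage equations of the method.\<close>

lemma ssp3_step_iff:
  fixes F :: "'a::real_vector \<Rightarrow> 'a"
  assumes n: "2 \<le> n"
  shows "shu_osher_step (ssp3 n) F \<tau> U Y \<longleftrightarrow>
    Y 1 = U \<and>
    (\<forall>j. 2 \<le> j \<and> j \<le> n^2 \<and> j \<noteq> ssp3_k n \<longrightarrow>
       Y j = Y (j - 1) + (\<tau> / (real n ^ 2 - real n)) *\<^sub>R F (Y (j - 1))) \<and>
    Y (ssp3_k n) = ((real n - 1) / (2 * real n - 1)) *\<^sub>R Y (ssp3_k n - 1)
      + (real n / (2 * real n - 1)) *\<^sub>R Y (ssp3_m n)
      + (\<tau> / (real n * (2 * real n - 1))) *\<^sub>R F (Y (ssp3_k n - 1)) \<and>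
    Y (n^2 + 1) = Y (n^2) + (\<tau> / (real n ^ 2 - real n)) *\<^sub>R F (Y (n^2))"
proof -
  let ?k = "ssp3_k n" and ?m = "ssp3_m n" and ?s = "n^2"
  let ?h = "\<tau> / (real n ^ 2 - real n)"
  let ?a = "(real n - 1) / (2 * real n - 1)" and ?b = "real n / (2 * real n - 1)"
  let ?c = "\<tau> / (real n * (2 * real n - 1))"
  note bnds = ssp3_index_bounds[OF n]
  define R where "R i = v_coeff (ssp3 n) i *\<^sub>R U
    + (\<Sum>j=1..?s. alpha_coeff (ssp3 n) i j *\<^sub>R Y j + (\<tau> * beta_coeff (ssp3 n) i j) *\<^sub>R F (Y j))" for i
  have R1: "R 1 = U"
    using bnds by (auto simp: R_def ssp3_def intro!: sum.neutral)
  have R: "R i = Y (i - 1) + ?h *\<^sub>R F (Y (i - 1))" if i: "2 \<le> i" "i \<le> ?s + 1" "i \<noteq> ?k" for i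
  proof -
    have "R i = (\<Sum>j=1..?s. alpha_coeff (ssp3 n) i j *\<^sub>R Y j + (\<tau> * beta_coeff (ssp3 n) i j) *\<^sub>R F (Y j))"
      using i by (simp add: R_def) (simp add: ssp3_def)
    also have "\<dots> = (\<Sum>j=1..?s. if j = i - 1 then Y j + ?h *\<^sub>R F (Y j) else 0)"
      by (rule sum.cong) (use i in \<open>auto simp: ssp3_def\<close>)
    also have "\<dots> = Y (i - 1) + ?h *\<^sub>R F (Y (i - 1))"
      using i by (subst sum.delta) auto
    finally show ?thesis .
  qed
  have Rk: "R ?k = ?a *\<^sub>R Y (?k - 1) + ?b *\<^sub>R Y ?m + ?c *\<^sub>R F (Y (?k - 1))"
  proof -
    have "R ?k = (\<Sum>j=1..?s. (if j = ?k - 1 then ?a *\<^sub>R Y j + ?c *\<^sub>R F (Y j) else 0)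
                              + (if j = ?m then ?b *\<^sub>R Y j else 0))"
      using bnds by (auto simp: R_def ssp3_def intro!: sum.cong)
    also have "\<dots> = ?a *\<^sub>R Y (?k - 1) + ?c *\<^sub>R F (Y (?k - 1)) + ?b *\<^sub>R Y ?m"
      using bnds unfolding sum.distrib by (subst (1 2) sum.delta) auto
    finally show ?thesis by (simp add: add_ac)
  qed
  have "shu_osher_step (ssp3 n) F \<tau> U Y \<longleftrightarrow> (\<forall>i\<in>{1..?s + 1}. Y i = R i)"
    by (simp add: shu_osher_step_def R_def) (simp add: ssp3_def)
  also have "{1..?s + 1} = {1, ?k, ?s + 1} \<union> {j. 2 \<le> j \<and> j \<le> ?s \<and> j \<noteq> ?k}"
    using bnds by auto
  also have "(\<forall>i\<in>{1, ?k, ?s + 1} \<union> {j. 2 \<le> j \<and> j \<le> ?s \<and> j \<noteq> ?k}. Y i = R i) \<longleftrightarrow>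
      Y 1 = R 1 \<and> (\<forall>j. 2 \<le> j \<and> j \<le> ?s \<and> j \<noteq> ?k \<longrightarrow> Y j = R j) \<and> Y ?k = R ?k \<and> Y (?s + 1) = R (?s + 1)"
    by blast
  also have "(\<forall>j. 2 \<le> j \<and> j \<le> ?s \<and> j \<noteq> ?k \<longrightarrow> Y j = R j) \<longleftrightarrow>
      (\<forall>j. 2 \<le> j \<and> j \<le> ?s \<and> j \<noteq> ?k \<longrightarrow> Y j = Y (j - 1) + ?h *\<^sub>R F (Y (j - 1)))"
    using R by auto
  also have "R (?s + 1) = Y ?s + ?h *\<^sub>R F (Y ?s)"
    using R[of "?s + 1"] bnds by simp
  finally show ?thesis unfolding R1 Rk .
qed

end

theory Submission
  imports Defs "HOL-Analysis.Harmonic_Numbers"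
begin

text \<open>
  Writing \<open>w = 1 + z / (n\<^sup>2 - n)\<close> turns every Euler stage of the method into a multiplication by \<open>w\<close>. The internal
  stability functions solve a backward recursion along the stages and become explicit polynomials in \<open>w\<close>; the
  first of them is the stability function
  \<open>P = w ^ (n - 1)\<^sup>2 ((n - 1) w ^ (2 n - 1) + n) / (2 n - 1)\<close>.

  By the reverse triangle inequality \<open>(2 n - 1) \<bar>P\<bar>\<close> is at least the value at \<open>\<bar>w\<bar>\<close> of the real function
  \<open>\<rho> ^ (n - 1)\<^sup>2 ((n - 1) \<rho> ^ (2 n - 1) - n)\<close> of \<open>\<rho>\<close>, with equality at \<open>w = - \<rho>\<close> wherever that value is nonnegative,
  because \<open>2 n - 1\<close> is odd. For \<open>\<rho> \<ge> 1\<close> this function equals \<open>2 n - 1\<close> precisely at the root \<open>\<nu>\<close> of \<^const>\<open>mu_minus\<close>, so the stability region lies in the disc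
  \<open>\<bar>w\<bar> \<le> \<nu>\<close> and touches its boundary at \<open>- \<nu>\<close>. Stage \<^const>\<open>ssp3_k\<close> has the internal stability function
  \<open>w ^ ((n\<^sup>2 - n) / 2)\<close>, which therefore attains \<open>\<nu> ^ ((n\<^sup>2 - n) / 2)\<close>. No other stage does worse: later stages have
  smaller powers, stages up to \<^const>\<open>ssp3_m\<close> are controlled by \<open>P\<close> itself, and the stages in between have
  a weight \<open>(n - 1) / (2 n - 1)\<close> that beats their at most \<open>2 n - 2\<close> additional factors \<open>w\<close> (\<open>nu_star_power_bound\<close>).

  Since for \<open>\<rho> \<ge> 1\<close> the inequality \<open>\<rho> < \<nu>\<close> holds exactly when the real function is below \<open>2 n - 1\<close> at \<open>\<rho>\<close>
  (\<open>less_nu_star_iff\<close>), the asymptotic bounds and the table reduce to evaluating it at single points. Near \<open>\<rho> = 1 + c / n\<^sup>2\<close> it behaves like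
  \<open>exp c * (2 c - 1)\<close>, which explains why \<open>c = ln n - ln (ln n)\<close> is too small and
  \<open>c = ln n - ln (ln n) / 8\<close> is too large; explicit error terms make this work for \<open>n \<ge> 9\<close>, respectively
  \<open>n \<ge> 20\<close>. The remaining cases and the table use powers computed with directed rounding.
\<close>

section \<open>Internal stability functions\<close>

lemma transpose_inverse_mult_vec:
  fixes A B :: "'a::comm_ring_1 mat"
  assumes "A \<in> carrier_mat s s" "B \<in> carrier_mat s s" "inverts_mat A B" "x \<in> carrier_vec s"
    and "A\<^sup>T *\<^sub>v x = r"
  shows "B\<^sup>T *\<^sub>v r = x"
proof -
  have "B\<^sup>T *\<^sub>v r = (B\<^sup>T * A\<^sup>T) *\<^sub>v x"
    using assms by (simp add: assoc_mult_mat_vec[of _ s s _ s])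
  also have "B\<^sup>T * A\<^sup>T = (A * B)\<^sup>T"
    using assms by (simp add: transpose_mult)
  also have "A * B = 1\<^sub>m s"
    using assms by (simp add: inverts_mat_def)
  finally show ?thesis using assms by simp
qed

text \<open>
  The internal stability functions are the unique solution \<open>Q\<close> of a backward recursion: with the convention
  \<open>Q\<^sub>s\<^sub>+\<^sub>1 = 1\<close>, the value \<open>Q\<^sub>j\<close> collects what every later stage \<open>i\<close> inherits from stage \<open>j\<close>, namely
  \<open>(\<alpha>\<^sub>i\<^sub>j + z \<beta>\<^sub>i\<^sub>j) Q\<^sub>i\<close>. Such a recursion is the transposed linear system that the inverse in
  \<^const>\<open>internal_stability_vec\<close> solves, so no inverse ever has to be computed.
\<close>

lemma internal_stability_fun_eqI:
  assumes expl: "\<And>i j. 1 \<le> i \<Longrightarrow> i \<le> j \<Longrightarrow> j \<le> num_stages M \<Longrightarrow>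
                   alpha_coeff M i j = 0 \<and> beta_coeff M i j = 0"
    and Q: "\<And>j. 1 \<le> j \<Longrightarrow> j \<le> num_stages M \<Longrightarrow>
              Q j = (\<Sum>i=1..num_stages M + 1.
                       (of_real (alpha_coeff M i j) + z * of_real (beta_coeff M i j)) * Q i)"
    and last: "Q (num_stages M + 1) = 1"
    and j: "1 \<le> j" "j \<le> num_stages M"
  shows "internal_stability_fun M j z = Q j"
proof -
  let ?s = "num_stages M" and ?A = "stage_mat M z"
  define x where "x = Matrix.vec ?s (\<lambda>i. Q (i + 1))"
  have A: "?A \<in> carrier_mat ?s ?s"
    by (auto simp: stage_mat_def alpha_mat_def beta_mat_def)
  have "?A\<^sup>T *\<^sub>v x = alpha_last M + z \<cdot>\<^sub>v beta_last M"
  proof (rule eq_vecI)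
    fix i assume "i < dim_vec (alpha_last M + z \<cdot>\<^sub>v beta_last M)"
    then have i: "i < ?s" by (simp add: beta_last_def)
    let ?c = "\<lambda>l. of_real (alpha_coeff M l (i + 1)) + z * of_real (beta_coeff M l (i + 1))"
    have "(?A\<^sup>T *\<^sub>v x) $ i = (\<Sum>l=0..<?s. ?A $$ (l, i) * Q (l + 1))"
      using i A by (simp add: scalar_prod_def x_def)
    also have "\<dots> = (\<Sum>l=0..<?s. (if l = i then Q (l + 1) else 0) - ?c (l + 1) * Q (l + 1))"
      using i by (intro sum.cong) (auto simp: stage_mat_def alpha_mat_def beta_mat_def algebra_simps)
    also have "\<dots> = Q (i + 1) - (\<Sum>l=0..<?s. ?c (l + 1) * Q (l + 1))"
      using i by (simp add: sum_subtractf)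
    also have "(\<Sum>l=0..<?s. ?c (l + 1) * Q (l + 1)) = (\<Sum>l=1..?s. ?c l * Q l)"
      by (rule sum.reindex_bij_witness[of _ "\<lambda>l. l - 1" "\<lambda>l. l + 1"]) auto
    also have "Q (i + 1) - \<dots> = ?c (?s + 1)"
      using Q[of "i + 1"] i last by simp
    finally show "(?A\<^sup>T *\<^sub>v x) $ i = (alpha_last M + z \<cdot>\<^sub>v beta_last M) $ i"
      using i by (simp add: alpha_last_def beta_last_def)
  qed (use A in \<open>simp add: beta_last_def\<close>)
  moreover obtain B where "mat_inverse ?A = Some B" "B \<in> carrier_mat ?s ?s" "inverts_mat ?A B"
    by (rule mat_inverse_stage_mat[of M z]) (use expl in blast)+
  ultimately have "internal_stability_vec M z = x"
    using transpose_inverse_mult_vec[OF A, of B x]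
    by (simp add: internal_stability_vec_def x_def)
  moreover have "Suc (j - Suc 0) = j" using j by simp
  ultimately show ?thesis using j by (simp add: internal_stability_fun_def x_def)
qed

text \<open>
  One Euler step of the method multiplies by this factor. It is an affine bijection of the plane, and all
  further analysis takes place in the variable \<open>w\<close> that it defines instead of \<open>z\<close>.
\<close>

definition euler_factor :: "nat \<Rightarrow> complex \<Rightarrow> complex" where
  "euler_factor n z = 1 + z / (of_nat n ^ 2 - of_nat n)"

text \<open>
  Closed form of \<open>Q\<^sub>j\<close> in the variable \<open>w\<close>. A perturbation of stage \<open>j\<close> reaches the output along the chain of
  Euler steps; before stage \<^const>\<open>ssp3_k\<close> this path has weight \<open>(n - 1) / (2 n - 1)\<close>, and a perturbation up to
  stage \<^const>\<open>ssp3_m\<close> also takes the shortcut from \<^const>\<open>ssp3_m\<close> to \<^const>\<open>ssp3_k\<close>. For \<open>j = 1\<close> this is the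
  stability function.
\<close>

definition ssp3_amplifier :: "nat \<Rightarrow> complex \<Rightarrow> nat \<Rightarrow> complex" where
  "ssp3_amplifier n w j =
     (if ssp3_k n \<le> j then w ^ (n^2 + 1 - j)
      else (of_nat n - 1) / (2 * of_nat n - 1) * w ^ (n^2 + 1 - j)
         + (if j \<le> ssp3_m n
            then of_nat n / (2 * of_nat n - 1) * w ^ (n^2 + 1 - ssp3_k n + (ssp3_m n - j)) else 0))"

text \<open>
  All exponents of \<open>w\<close> come from these identities: \<open>(n\<^sup>2 - n) / 2\<close> Euler steps start from stage \<^const>\<open>ssp3_k\<close> or
  a later one, and a path through the shortcut has \<open>2 n - 1\<close> fewer factors \<open>w\<close> than the full chain of \<open>n\<^sup>2\<close>.
\<close>

lemma ssp3_index_arith: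
  assumes "2 \<le> n"
  shows "n^2 + 1 - ssp3_k n = (n^2 - n) div 2"
    and "n^2 - ssp3_m n = (n^2 - n) div 2 + (2 * n - 2)"
    and "(n^2 - n) div 2 + (ssp3_m n - 1) = (n - 1)^2"
    and "n^2 = (n - 1)^2 + (2 * n - 1)"
proof -
  obtain p where n: "n = p + 2" using assms by (metis add.commute le_Suc_ex)
  \<comment> \<open>Halving \<open>p (p + 1)\<close> makes every index an expression linear in \<open>p\<close> and \<open>q\<close>.\<close>
  obtain q where q: "p * (p + 1) = 2 * q" by (metis even_mult_iff odd_add odd_one evenE)
  have 1: "n * (n + 1) = 2 * (q + 2 * p + 3)" "(n - 1) * (n - 2) = 2 * q"
          "n^2 - n = 2 * (q + p + 1)" "n^2 = 2 * q + 3 * p + 4" "(n - 1)^2 = 2 * q + p + 1"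
    using q by (simp_all add: n algebra_simps power2_eq_square)
  have k: "ssp3_k n = q + 2 * p + 4" and m: "ssp3_m n = q + 1"
    unfolding ssp3_k_def ssp3_m_def 1 by simp_all
  show "n^2 + 1 - ssp3_k n = (n^2 - n) div 2"
    and "n^2 - ssp3_m n = (n^2 - n) div 2 + (2 * n - 2)"
    and "(n^2 - n) div 2 + (ssp3_m n - 1) = (n - 1)^2"
    and "n^2 = (n - 1)^2 + (2 * n - 1)"
    unfolding k m 1 by (simp_all add: n)
qed

lemma two_mult_of_nat_minus_1_neq_0: "(2 * of_nat n - 1 :: complex) \<noteq> 0"
proof
  assume "(2 * of_nat n - 1 :: complex) = 0"
  then have "(of_nat (2 * n) :: complex) = of_nat 1" by simp
  then show False unfolding of_nat_eq_iff by presburger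
qed

lemma ssp3_coeff_combined:
  fixes z :: complex
  assumes n: "2 \<le> n" and j: "1 \<le> j"
  shows "of_real (alpha_coeff (ssp3 n) i j) + z * of_real (beta_coeff (ssp3 n) i j) =
    (if i = j + 1 then (if i = ssp3_k n then (of_nat n - 1) / (2 * of_nat n - 1) else 1) * euler_factor n z else 0)
    + (if i = ssp3_k n \<and> j = ssp3_m n then of_nat n / (2 * of_nat n - 1) else 0)"
proof -
  have nz: "(of_nat n :: complex) \<noteq> 0" "(of_nat n :: complex) \<noteq> 1"
    using n by auto
  note two_mult_of_nat_minus_1_neq_0[of n]
  moreover have "(of_nat n ^ 2 - of_nat n :: complex) = of_nat n * (of_nat n - 1)"
    by (simp add: power2_eq_square algebra_simps)
  ultimately have "(of_nat n - 1) / (2 * of_nat n - 1) + z * (1 / (of_nat n * (2 * of_nat n - 1)))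
      = (of_nat n - 1) / (2 * of_nat n - 1) * euler_factor n z"
    using nz by (simp add: euler_factor_def divide_simps)
  moreover have "1 + z * (1 / (of_nat n ^ 2 - of_nat n)) = euler_factor n z"
    by (simp add: euler_factor_def)
  ultimately show ?thesis
    using j ssp3_index_bounds[OF n] by (auto simp: ssp3_def)
qed

lemma ssp3_amplifier_recursion:
  assumes n: "2 \<le> n" and j: "1 \<le> j" "j \<le> n^2"
  shows "ssp3_amplifier n w j =
    (if j + 1 = ssp3_k n then (of_nat n - 1) / (2 * of_nat n - 1) else 1) * w * ssp3_amplifier n w (j + 1)
    + (if j = ssp3_m n then of_nat n / (2 * of_nat n - 1) * ssp3_amplifier n w (ssp3_k n) else 0)"
proof -
  note b = ssp3_index_bounds[OF n]
  have 1: "w ^ (n\<^sup>2 + 1 - j) = w * w ^ (n\<^sup>2 + 1 - (j + 1))"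
    using j by (simp add: Suc_diff_le)
  consider "ssp3_k n \<le> j" | "j + 1 = ssp3_k n" | "ssp3_m n < j" "j + 1 < ssp3_k n"
    | "j = ssp3_m n" | "j < ssp3_m n" by linarith
  then show ?thesis
  proof cases
    case 5
    then have 2: "ssp3_m n - j = Suc (ssp3_m n - (j + 1))" by simp
    show ?thesis using b 5 unfolding ssp3_amplifier_def 1 2 by (simp add: algebra_simps)
  next
    case 4
    then show ?thesis using b unfolding ssp3_amplifier_def 1 by simp
  next
    case 3
    then show ?thesis using b unfolding ssp3_amplifier_def 1 by simp
  next
    case 2
    then show ?thesis using b unfolding ssp3_amplifier_def 1 by simp
  next
    case 1
    then show ?thesis using b unfolding ssp3_amplifier_def \<open>w ^ (n\<^sup>2 + 1 - j) = _\<close> by simp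
  qed
qed

lemma internal_stability_ssp3:
  assumes n: "2 \<le> n" and j: "1 \<le> j" "j \<le> n^2"
  shows "internal_stability_fun (ssp3 n) j z = ssp3_amplifier n (euler_factor n z) j"
proof (rule internal_stability_fun_eqI)
  have s: "num_stages (ssp3 n) = n^2" by (simp add: ssp3_def)
  note b = ssp3_index_bounds[OF n]
  let ?w = "euler_factor n z"
  show "ssp3_amplifier n ?w (num_stages (ssp3 n) + 1) = 1"
    using b by (simp add: s ssp3_amplifier_def)
  show "1 \<le> j" "j \<le> num_stages (ssp3 n)" using j s by auto
  show "alpha_coeff (ssp3 n) i l = 0 \<and> beta_coeff (ssp3 n) i l = 0"
    if "1 \<le> i" "i \<le> l" for i l
    using ssp3_explicit[OF n that] .
  fix l assume l: "1 \<le> l" "l \<le> num_stages (ssp3 n)"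
  let ?a = "(if l + 1 = ssp3_k n then (of_nat n - 1) / (2 * of_nat n - 1) else 1) * ?w"
  let ?b = "if l = ssp3_m n then of_nat n / (2 * of_nat n - 1) else 0"
  have "(\<Sum>i=1..num_stages (ssp3 n) + 1.
          (of_real (alpha_coeff (ssp3 n) i l) + z * of_real (beta_coeff (ssp3 n) i l)) * ssp3_amplifier n ?w i)
      = (\<Sum>i=1..n^2+1. (if i = l + 1 then ?a * ssp3_amplifier n ?w i else 0)
                     + (if i = ssp3_k n then ?b * ssp3_amplifier n ?w i else 0))"
    unfolding s by (rule sum.cong) (auto simp: ssp3_coeff_combined[OF n l(1)] algebra_simps)
  also have "\<dots> = ?a * ssp3_amplifier n ?w (l + 1) + ?b * ssp3_amplifier n ?w (ssp3_k n)"
    using l s b unfolding sum.distrib by (subst (1 2) sum.delta) auto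
  also have "\<dots> = ssp3_amplifier n ?w l"
    using ssp3_amplifier_recursion[OF n, of l ?w] l s by (auto simp: algebra_simps)
  finally show "ssp3_amplifier n ?w l = (\<Sum>i=1..num_stages (ssp3 n) + 1.
          (of_real (alpha_coeff (ssp3 n) i l) + z * of_real (beta_coeff (ssp3 n) i l)) * ssp3_amplifier n ?w i)" ..
qed

lemma stability_fun_ssp3:
  assumes n: "2 \<le> n"
  shows "stability_fun (ssp3 n) z = ssp3_amplifier n (euler_factor n z) 1"
proof -
  let ?q = "internal_stability_vec (ssp3 n) z"
  have s: "num_stages (ssp3 n) = n^2" by (simp add: ssp3_def)
  have "v_vec (ssp3 n) = unit_vec (n^2) 0"
    using n by (auto simp: v_vec_def ssp3_def unit_vec_def)
  moreover have "?q \<in> carrier_vec (n^2)"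
  proof -
    obtain B where "mat_inverse (stage_mat (ssp3 n) z) = Some B" "B \<in> carrier_mat (n^2) (n^2)"
      by (rule mat_inverse_stage_mat[of "ssp3 n" z]) (use ssp3_explicit[OF n] s in auto)
    then show ?thesis by (intro carrier_vecI) (simp add: internal_stability_vec_def)
  qed
  moreover have "v_coeff (ssp3 n) (n^2 + 1) = 0" using n by (simp add: ssp3_def)
  ultimately have "stability_fun (ssp3 n) z = ?q $ 0"
    using n by (simp add: stability_fun_def s scalar_prod_right_unit)
  then show ?thesis
    using internal_stability_ssp3[OF n, of 1 z] n by (simp add: internal_stability_fun_def)
qed

section \<open>The radius of the stability region\<close>

text \<open>
  The modulus of \<open>(2 n - 1) P\<close> in the variable \<open>w\<close> is at least this function of \<open>\<bar>w\<bar>\<close>, by the reverse triangle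
  inequality, with equality on the negative real axis beyond the point where the two terms balance. Hence
  the region \<open>\<bar>P\<bar> \<le> 1\<close> reaches out exactly to the radius where it equals \<open>2 n - 1\<close>.
\<close>

definition boundary_fun :: "nat \<Rightarrow> real \<Rightarrow> real" where
  "boundary_fun n \<rho> = \<rho> ^ ((n - 1)^2) * ((real n - 1) * \<rho> ^ (2 * n - 1) - real n)"

lemma mu_minus_eq_0_iff:
  assumes "2 \<le> n"
  shows "mu_minus n \<rho> = 0 \<longleftrightarrow> boundary_fun n \<rho> = 2 * real n - 1"
proof -
  have "real n * \<rho> ^ ((n - 1)^2) * (1 - (1 - 1 / real n) * \<rho> ^ (2 * n - 1))
      = \<rho> ^ ((n - 1)^2) * (real n * (1 - (1 - 1 / real n) * \<rho> ^ (2 * n - 1)))"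
    by simp
  also have "real n * (1 - (1 - 1 / real n) * \<rho> ^ (2 * n - 1)) = real n - (real n - 1) * \<rho> ^ (2 * n - 1)"
    using assms by (simp add: field_simps)
  also have "\<rho> ^ ((n - 1)^2) * (real n - (real n - 1) * \<rho> ^ (2 * n - 1)) = - boundary_fun n \<rho>"
    by (simp add: boundary_fun_def right_diff_distrib)
  finally show ?thesis using assms unfolding mu_minus_def by (auto simp: divide_eq_eq)
qed

text \<open>
  The function starts at \<open>-1\<close> for \<open>\<rho> = 1\<close> and need not be monotone while it is negative: there the growing
  power is multiplied by a negative bracket. Where it is nonnegative, both factors increase.
\<close>

lemma boundary_fun_strict_mono:
  assumes n: "2 \<le> n" and "1 \<le> \<rho>" "\<rho> < \<sigma>" and pos: "0 \<le> boundary_fun n \<rho>"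
  shows "boundary_fun n \<rho> < boundary_fun n \<sigma>"
proof -
  let ?g = "\<lambda>x. (real n - 1) * x ^ (2 * n - 1) - real n"
  have "0 < \<rho> ^ ((n - 1)^2)" using assms by simp
  then have "0 \<le> ?g \<rho>"
    using pos by (simp add: boundary_fun_def zero_le_mult_iff)
  moreover have "\<rho> ^ (2 * n - 1) < \<sigma> ^ (2 * n - 1)"
    using assms by (intro power_strict_mono) auto
  then have "?g \<rho> < ?g \<sigma>" using n by simp
  moreover have "\<rho> ^ ((n - 1)^2) \<le> \<sigma> ^ ((n - 1)^2)"
    using assms by (intro power_mono) auto
  ultimately show ?thesis
    using \<open>0 < \<rho> ^ ((n - 1)^2)\<close> unfolding boundary_fun_def
    by (intro mult_le_less_imp_less) auto
qed

lemma ex1_boundary_fun_root: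
  assumes n: "2 \<le> n"
  shows "\<exists>!\<rho>. 1 \<le> \<rho> \<and> mu_minus n \<rho> = 0"
proof -
  have "\<exists>\<rho>\<ge>1. \<rho> \<le> 2 \<and> boundary_fun n \<rho> = 2 * real n - 1"
  proof (rule IVT')
    have "(2::real) ^ 3 \<le> 2 ^ (2 * n - 1)" using n by (intro power_increasing) auto
    then have "(real n - 1) * 8 \<le> (real n - 1) * 2 ^ (2 * n - 1)"
      using n by (intro mult_left_mono) auto
    then have "2 * real n - 1 \<le> 1 * ((real n - 1) * 2 ^ (2 * n - 1) - real n)" using n by simp
    also have "\<dots> \<le> boundary_fun n 2"
      unfolding boundary_fun_def using calculation n by (intro mult_right_mono) auto
    finally show "2 * real n - 1 \<le> boundary_fun n 2" .
    show "continuous_on {1..2} (boundary_fun n)"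
      unfolding boundary_fun_def by (intro continuous_intros)
  qed (use n in \<open>auto simp: boundary_fun_def\<close>)
  then obtain \<rho> where "1 \<le> \<rho>" "boundary_fun n \<rho> = 2 * real n - 1" by blast
  moreover have "\<sigma> = \<rho>" if "1 \<le> \<sigma>" "boundary_fun n \<sigma> = 2 * real n - 1" for \<sigma>
    using boundary_fun_strict_mono[OF n, of \<rho> \<sigma>] boundary_fun_strict_mono[OF n, of \<sigma> \<rho>] calculation that n
    by (cases \<rho> \<sigma> rule: linorder_cases) auto
  ultimately show ?thesis
    unfolding mu_minus_eq_0_iff[OF n] by blast
qed

lemma nu_star_root:
  assumes n: "2 \<le> n"
  shows "1 \<le> nu_star n" and "boundary_fun n (nu_star n) = 2 * real n - 1"
  using theI'[OF ex1_boundary_fun_root[OF n]]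
  by (simp_all add: nu_star_def mu_minus_eq_0_iff[OF n])

text \<open>
  Every later estimate of \<^const>\<open>nu_star\<close> evaluates \<^const>\<open>boundary_fun\<close> at a single point and compares it with
  \<open>2 n - 1\<close>.
\<close>

lemma
  assumes n: "2 \<le> n" and \<rho>: "1 \<le> \<rho>"
  shows less_nu_star_iff: "\<rho> < nu_star n \<longleftrightarrow> boundary_fun n \<rho> < 2 * real n - 1"
    and nu_star_less_iff: "nu_star n < \<rho> \<longleftrightarrow> 2 * real n - 1 < boundary_fun n \<rho>"
proof -
  have d: "0 < 2 * real n - 1" using n by simp
  have "boundary_fun n \<rho> < 2 * real n - 1" if "\<rho> < nu_star n"
    using boundary_fun_strict_mono[OF n \<rho> that] nu_star_root(2)[OF n] d by linarith
  moreover have "2 * real n - 1 < boundary_fun n \<rho>" if "nu_star n < \<rho>"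
    using boundary_fun_strict_mono[OF n nu_star_root(1)[OF n] that] nu_star_root(2)[OF n] d by simp
  moreover have "boundary_fun n \<rho> = 2 * real n - 1" if "\<rho> = nu_star n"
    using nu_star_root(2)[OF n] that by simp
  ultimately show "\<rho> < nu_star n \<longleftrightarrow> boundary_fun n \<rho> < 2 * real n - 1"
    and "nu_star n < \<rho> \<longleftrightarrow> 2 * real n - 1 < boundary_fun n \<rho>"
    by (metis linorder_less_linear order_less_asym order_less_irrefl)+
qed

text \<open>
  For the stages between \<^const>\<open>ssp3_m\<close> and \<^const>\<open>ssp3_k\<close> the exponent of \<open>w\<close> rises up to \<open>(n\<^sup>2 - n) / 2 + 2 n - 2\<close>,
  but they also have the weight \<open>(n - 1) / (2 n - 1)\<close>; this inequality says that the weight wins. If it failed, then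
  \<open>\<nu> ^ (n - 1)\<^sup>2\<close> would be so large that the defining equation forces \<open>\<nu> < 1\<close>. For \<open>n = 2\<close> the exponent
  \<open>(n - 1)\<^sup>2 = 1\<close> is too small for that argument and the numbers decide.
\<close>

lemma nu_star_power_bound:
  assumes n: "2 \<le> n"
  shows "(real n - 1) * nu_star n ^ (2 * n - 2) \<le> 2 * real n - 1"
proof (rule ccontr)
  let ?\<nu> = "nu_star n" and ?d = "2 * real n - 1"
  define p t where "p = ?\<nu> ^ (n - 1)" and "t = ?\<nu> ^ ((n - 1)^2)"
  assume "\<not> ?thesis"
  moreover have "?\<nu> ^ (2 * n - 2) = p\<^sup>2"
    unfolding p_def power_mult[symmetric] by (rule arg_cong[of _ _ "\<lambda>i. ?\<nu> ^ i"]) simp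
  ultimately have big: "?d < (real n - 1) * p\<^sup>2" by simp
  have \<nu>: "1 \<le> ?\<nu>" and t: "1 \<le> t" and p: "1 \<le> p"
    using nu_star_root[OF n] by (simp_all add: t_def p_def)
  have "2 * n - 1 = Suc (2 * n - 2)" using n by simp
  then have "?\<nu> ^ (2 * n - 1) = ?\<nu> * p\<^sup>2"
    using \<open>?\<nu> ^ (2 * n - 2) = p\<^sup>2\<close> by simp
  then have "t * ((real n - 1) * (?\<nu> * p\<^sup>2) - real n) = ?d"
    using nu_star_root(2)[OF n] by (simp add: boundary_fun_def t_def)
  then have root: "real n + ?d / t = ?\<nu> * ((real n - 1) * p\<^sup>2)"
    using t by (simp add: field_simps)
  have "?\<nu> * ?d < ?\<nu> * ((real n - 1) * p\<^sup>2)"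
    using big \<nu> by simp
  then have *: "?\<nu> * ?d < real n + ?d / t" unfolding root .
  show False
  proof (cases "n = 2")
    case True
    then have \<open>t = ?\<nu>\<close> \<open>3 < ?\<nu>\<^sup>2\<close> using big by (simp_all add: t_def p_def)
    moreover from this have "3 / ?\<nu> < ?\<nu>" using \<nu> by (simp add: field_simps power2_eq_square)
    ultimately have "?\<nu> < 1" using * True by (simp split: if_splits)
    then show False using \<nu> by simp
  next
    case False
    then have "p\<^sup>2 \<le> t"
      unfolding p_def t_def power_mult[symmetric] using \<nu> n
      by (intro power_increasing) (auto simp: power2_eq_square)
    then have "(real n - 1) * p\<^sup>2 \<le> (real n - 1) * t"
      using n by (intro mult_left_mono) auto
    then have "?d < (real n - 1) * t"
      using big by linarith
    then have "real n + ?d / t < ?d" using t by (simp add: field_simps)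
    moreover have "?d \<le> ?\<nu> * ?d" using \<nu> n by (simp add: mult_le_cancel_right1)
    ultimately show False using * by simp
  qed
qed

section \<open>The maximum internal amplification factor\<close>

lemma ssp3_amplifier_1:
  assumes n: "2 \<le> n"
  shows "(2 * of_nat n - 1) * ssp3_amplifier n w 1
    = w ^ ((n - 1)^2) * ((of_nat n - 1) * w ^ (2 * n - 1) + of_nat n)"
proof -
  note ar = ssp3_index_arith[OF n]
  note two_mult_of_nat_minus_1_neq_0[of n]
  moreover have "ssp3_amplifier n w 1 = (of_nat n - 1) / (2 * of_nat n - 1) * w ^ ((n - 1)\<^sup>2 + (2 * n - 1))
      + of_nat n / (2 * of_nat n - 1) * w ^ ((n - 1)\<^sup>2)"
    using ssp3_index_bounds[OF n] ar(1,3) unfolding ssp3_amplifier_def ar(4)[symmetric]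
    by simp
  moreover have "d * (a / d * (u * v) + b / d * u) = u * (a * v + b)" if "d \<noteq> 0" for a b d u v :: complex
    using that by (simp add: field_simps)
  ultimately show ?thesis unfolding power_add by metis
qed

lemma cmod_of_nat_minus_1:
  assumes "2 \<le> n"
  shows "cmod (of_nat n - 1) = real n - 1" "cmod (2 * of_nat n - 1) = 2 * real n - 1"
  using assms norm_of_real[of "real n - 1", where 'a = complex]
    norm_of_real[of "2 * real n - 1", where 'a = complex] by simp_all

lemma boundary_fun_le_norm:
  assumes n: "2 \<le> n"
  shows "boundary_fun n (cmod w) \<le> (2 * real n - 1) * cmod (ssp3_amplifier n w 1)"
proof -
  note cn = cmod_of_nat_minus_1[OF n]
  have "(real n - 1) * cmod w ^ (2 * n - 1) - real n
      \<le> cmod ((of_nat n - 1) * w ^ (2 * n - 1) + of_nat n)"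
    using norm_diff_ineq[of "(of_nat n - 1) * w ^ (2 * n - 1)" "of_nat n"]
    by (simp add: norm_mult norm_power cn)
  then have "boundary_fun n (cmod w)
      \<le> cmod w ^ ((n - 1)^2) * cmod ((of_nat n - 1) * w ^ (2 * n - 1) + of_nat n)"
    unfolding boundary_fun_def by (intro mult_left_mono) auto
  also have "\<dots> = cmod ((2 * of_nat n - 1) * ssp3_amplifier n w 1)"
    unfolding ssp3_amplifier_1[OF n] by (simp add: norm_mult norm_power)
  finally show ?thesis by (simp add: norm_mult cn)
qed

lemma norm_le_nu_star:
  assumes n: "2 \<le> n" and "cmod (ssp3_amplifier n w 1) \<le> 1"
  shows "cmod w \<le> nu_star n"
proof (rule ccontr)
  assume "\<not> ?thesis"
  then have "nu_star n < cmod w" by simp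
  then have "2 * real n - 1 < boundary_fun n (cmod w)"
    using nu_star_less_iff[OF n, of "cmod w"] nu_star_root[OF n] by simp
  also have "\<dots> \<le> (2 * real n - 1) * 1"
  proof -
    have "(2 * real n - 1) * cmod (ssp3_amplifier n w 1) \<le> (2 * real n - 1) * 1"
      using assms by (intro mult_left_mono) auto
    then show ?thesis using boundary_fun_le_norm[OF n, of w] by linarith
  qed
  finally show False by simp
qed

text \<open>
  No stage is amplified by more than the factor reached by stage \<^const>\<open>ssp3_k\<close>. From that stage on,
  \<open>Q\<^sub>j\<close> is a pure power of \<open>w\<close> with at most that exponent; for the stages in the middle the weight compensates
  the additional powers; and up to stage \<^const>\<open>ssp3_m\<close> one has \<open>w ^ (j - 1) Q\<^sub>j = P\<close>, so that \<open>\<bar>Q\<^sub>j\<bar> \<le> 1\<close> holds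
  outside the unit disc because of \<open>\<bar>P\<bar> \<le> 1\<close>, and inside because the weights add up to 1.
\<close>

lemma norm_ssp3_amplifier_le:
  assumes n: "2 \<le> n" and P: "cmod (ssp3_amplifier n w 1) \<le> 1" and j: "1 \<le> j" "j \<le> n^2"
  shows "cmod (ssp3_amplifier n w j) \<le> nu_star n ^ ((n^2 - n) div 2)"
proof -
  let ?\<nu> = "nu_star n" and ?r = "cmod w" and ?A = "(n^2 - n) div 2" and ?d = "2 * real n - 1"
  note b = ssp3_index_bounds[OF n] and ar = ssp3_index_arith[OF n]
  note cn = cmod_of_nat_minus_1[OF n]
  have r: "?r \<le> ?\<nu>" using norm_le_nu_star[OF n P] .
  have \<nu>: "1 \<le> ?\<nu>" using nu_star_root[OF n] by simp
  have pow: "?r ^ i \<le> ?\<nu> ^ l" if "i \<le> l" for i l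
    using power_mono[OF r, of i] power_increasing[OF that \<nu>] by simp
  have \<nu>A: "1 \<le> ?\<nu> ^ ?A" using \<nu> by simp
  have d: "0 < ?d" using n by simp
  consider "ssp3_k n \<le> j" | "ssp3_m n < j" "j < ssp3_k n" | "j \<le> ssp3_m n" by linarith
  then show ?thesis
  proof cases
    case 1
    then show ?thesis using ar(1) pow[of "n^2 + 1 - j" ?A] by (simp add: ssp3_amplifier_def norm_power)
  next
    case 2
    then have "cmod (ssp3_amplifier n w j) = (real n - 1) / ?d * ?r ^ (n^2 + 1 - j)"
      by (simp add: ssp3_amplifier_def norm_mult norm_divide norm_power cn)
    also have "\<dots> \<le> (real n - 1) / ?d * ?\<nu> ^ (?A + (2 * n - 2))"
      using n 2 ar(2) by (intro mult_left_mono pow) auto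
    also have "\<dots> = ((real n - 1) * ?\<nu> ^ (2 * n - 2) / ?d) * ?\<nu> ^ ?A"
      by (simp add: power_add)
    also have "\<dots> \<le> 1 * ?\<nu> ^ ?A"
      using nu_star_power_bound[OF n] d \<nu> by (intro mult_right_mono) auto
    finally show ?thesis by simp
  next
    case 3
    show ?thesis
    proof (cases "1 \<le> ?r")
      case True
      have "w ^ (j - 1) * ssp3_amplifier n w j = ssp3_amplifier n w 1"
      proof -
        have "w ^ (n^2 + 1 - 1) = w ^ (j - 1) * w ^ (n^2 + 1 - j)"
          using j by (simp flip: power_add)
        moreover have "w ^ (n^2 + 1 - ssp3_k n + (ssp3_m n - 1))
            = w ^ (j - 1) * w ^ (n^2 + 1 - ssp3_k n + (ssp3_m n - j))"
          using j 3 by (simp flip: power_add)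
        ultimately show ?thesis
          using 3 b j unfolding ssp3_amplifier_def by (simp add: algebra_simps)
      qed
      then have "?r ^ (j - 1) * cmod (ssp3_amplifier n w j) \<le> 1"
        using P by (metis norm_mult norm_power)
      moreover have "1 * cmod (ssp3_amplifier n w j) \<le> ?r ^ (j - 1) * cmod (ssp3_amplifier n w j)"
        using True by (intro mult_right_mono) auto
      ultimately show ?thesis using \<nu>A by simp
    next
      case False
      then have le1: "?r ^ i \<le> 1" for i by (simp add: power_le_one)
      have "cmod (ssp3_amplifier n w j)
          \<le> (real n - 1) / ?d * ?r ^ (n^2 + 1 - j)
            + real n / ?d * ?r ^ (n^2 + 1 - ssp3_k n + (ssp3_m n - j))"
        using 3 b unfolding ssp3_amplifier_def
        by (auto intro!: norm_triangle_mono simp: norm_mult norm_divide norm_power cn)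
      also have "\<dots> \<le> (real n - 1) / ?d * 1 + real n / ?d * 1"
        using n by (intro add_mono mult_left_mono le1) auto
      also have "\<dots> = 1" using d by (simp flip: add_divide_distrib)
      finally show ?thesis using \<nu>A by simp
    qed
  qed
qed

text \<open>
  The bound is attained at \<open>w = - \<nu>\<close>: the exponent \<open>2 n - 1\<close> is odd, so the two terms of \<open>P\<close> have opposite signs
  and the reverse triangle inequality is an equality there.
\<close>

lemma ssp3_amplifier_extremal:
  assumes n: "2 \<le> n"
  defines "w \<equiv> - of_real (nu_star n)"
  shows "cmod (ssp3_amplifier n w 1) = 1"
    and "cmod (ssp3_amplifier n w (ssp3_k n)) = nu_star n ^ ((n^2 - n) div 2)"
proof -
  let ?\<nu> = "nu_star n"
  define d where "d = 2 * real n - 1"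
  have \<nu>: "1 \<le> ?\<nu>" and d: "0 < d" using nu_star_root[OF n] n by (simp_all add: d_def)
  have odd: "odd (2 * n - 1)" using n by presburger
  have w: "cmod w = ?\<nu>" using \<nu> by (simp add: w_def)
  have "of_real d * ssp3_amplifier n w 1
      = w ^ ((n - 1)^2) * of_real (real n - (real n - 1) * ?\<nu> ^ (2 * n - 1))"
    using ssp3_amplifier_1[OF n, of w] odd by (simp add: w_def d_def)
  then have "d * cmod (ssp3_amplifier n w 1)
      = ?\<nu> ^ ((n - 1)^2) * \<bar>real n - (real n - 1) * ?\<nu> ^ (2 * n - 1)\<bar>"
    using d w by (metis abs_of_pos norm_mult norm_of_real norm_power)
  also have "\<dots> = \<bar>boundary_fun n ?\<nu>\<bar>"
    unfolding boundary_fun_def abs_mult using \<nu> by (subst abs_minus_commute) simp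
  also have "\<dots> = d"
    unfolding nu_star_root(2)[OF n] using d by (simp add: d_def)
  finally show "cmod (ssp3_amplifier n w 1) = 1"
    using d by simp
  show "cmod (ssp3_amplifier n w (ssp3_k n)) = ?\<nu> ^ ((n^2 - n) div 2)"
    by (simp only: ssp3_amplifier_def ssp3_index_arith(1)[OF n] norm_power w order_refl if_True)
qed

lemma ssp3_amplification_eq:
  assumes n: "2 \<le> n"
  shows "ssp3_amplification n = ereal (nu_star n ^ ((n^2 - n) div 2))"
proof -
  let ?M = "ssp3 n" and ?B = "ereal (nu_star n ^ ((n^2 - n) div 2))"
  have s: "num_stages ?M = n^2" by (simp add: ssp3_def)
  have region: "z \<in> stability_region ?M \<longleftrightarrow> cmod (ssp3_amplifier n (euler_factor n z) 1) \<le> 1" for z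
    by (simp add: stability_region_def stability_fun_ssp3[OF n])
  have k: "ssp3_k n \<in> {1..n^2}" using ssp3_index_bounds[OF n] by simp
  let ?S = "\<lambda>j. SUP z\<in>stability_region ?M. ereal (cmod (internal_stability_fun ?M j z))"
  have le: "?S j \<le> ?B" if "j \<in> {1..n^2}" for j
    using that norm_ssp3_amplifier_le[OF n]
    by (intro SUP_least) (auto simp: region internal_stability_ssp3[OF n])
  define w z where "w = - complex_of_real (nu_star n)" and "z = (w - 1) * (of_nat n ^ 2 - of_nat n)"
  have "(of_nat n ^ 2 - of_nat n :: complex) \<noteq> 0"
    using n by (simp add: power2_eq_square)
  then have ez: "euler_factor n z = w" by (simp add: euler_factor_def z_def)
  have "?B = ereal (cmod (internal_stability_fun ?M (ssp3_k n) z))"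
    using k ssp3_amplifier_extremal(2)[OF n] by (simp add: internal_stability_ssp3[OF n] ez w_def)
  also have "\<dots> \<le> ?S (ssp3_k n)"
    using ssp3_amplifier_extremal(1)[OF n] by (intro SUP_upper) (simp add: region ez w_def)
  finally have "?B = ?S (ssp3_k n)" using le[OF k] by simp
  then show ?thesis
    unfolding ssp3_amplification_def max_internal_amplification_def s
    using le k by (intro Max_eqI) auto
qed

section \<open>Bounds on logarithms\<close>

lemma ln_2_lower: "693 / 1000 \<le> ln (2::real)"
  using ln_approx_bounds[of 2 3] by (simp add: eval_nat_numeral)

lemma ln_3_bounds: "1098 / 1000 \<le> ln (3::real)" "ln (3::real) \<le> 10987 / 10000"
  using ln_approx_bounds[of 3 4] by (simp_all add: eval_nat_numeral)

text \<open>
  As \<open>2.7\<close> lies just below \<open>e\<close>, the tangent of the logarithm at \<open>2.7\<close> is almost the line of slope \<open>1 / e\<close>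
  through the origin; dropping its nonpositive constant keeps a bound that is linear in \<open>x\<close>.
\<close>

lemma ln_27_10_upper: "ln (27 / 10 :: real) \<le> 1"
  using ln_approx_bounds[of "27 / 10" 3] by (simp add: eval_nat_numeral)

lemma ln_le_tangent:
  fixes x c :: real
  assumes "0 < c" "0 < x"
  shows "ln x \<le> ln c + (x / c - 1)"
proof -
  have "ln (x / c) \<le> x / c - 1" using assms by (intro ln_le_minus_one) simp
  then show ?thesis using assms by (simp add: ln_div)
qed

lemma ln_le_divide_27_10:
  fixes x :: real
  assumes "0 < x"
  shows "ln x \<le> x / (27 / 10)"
  using ln_le_tangent[of "27 / 10" x] ln_27_10_upper assms by simp

lemma ln_ge_one_minus_inverse:
  fixes x :: real
  assumes "0 < x"
  shows "1 - 1 / x \<le> ln x"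
  using ln_le_minus_one[of "1 / x"] assms by (simp add: ln_div)

lemma exp_diff_lower:
  fixes a c :: real
  shows "exp a * (1 - c) \<le> exp (a - c)"
proof -
  have "1 - c \<le> exp (- c)" using exp_ge_add_one_self[of "- c"] by simp
  then have "exp a * (1 - c) \<le> exp a * exp (- c)" by (intro mult_left_mono) auto
  then show ?thesis by (simp flip: exp_add)
qed

lemma ln_9_bounds: "2196 / 1000 \<le> ln (9::real)" "ln (9::real) \<le> 21974 / 10000"
proof -
  have "ln (9::real) = 2 * ln 3" using ln_realpow[of 3 2] by simp
  then show "2196 / 1000 \<le> ln (9::real)" "ln (9::real) \<le> 21974 / 10000"
    using ln_3_bounds by simp_all
qed

lemma ln_10_lower: "2296 / 1000 \<le> ln (10::real)"
  using ln_ge_one_minus_inverse[of "10 / 9 :: real"] ln_9_bounds by (simp add: ln_div)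

lemma ln_12_lower: "2484 / 1000 \<le> ln (12::real)"
proof -
  have "ln (12::real) = ln 2 + (ln 2 + ln 3)"
    using ln_mult[of 2 "6 :: real"] ln_mult[of 2 "3 :: real"] by simp
  then show ?thesis using ln_2_lower ln_3_bounds by simp
qed

lemma ln_16_lower: "2772 / 1000 \<le> ln (16::real)"
  using ln_realpow[of 2 4] ln_2_lower by simp

text \<open>
  The elementary bounds on \<open>L = ln n\<close> and \<open>ln L\<close> used for \<open>n \<ge> 9\<close>. The upper bounds come from tangents of the
  concave logarithm: \<open>ln L \<le> L / 2.7\<close> is (almost) the tangent at \<open>e\<close>, which is close to the relevant \<open>L\<close> for
  moderate \<open>n\<close>; the same bound at \<open>sqrt n\<close> gives \<open>L\<^sup>2 = O(n)\<close>.
\<close>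

lemma ln_nat_bounds:
  assumes "9 \<le> n"
  shows "2196 / 1000 \<le> ln (real n)" "782 / 1000 \<le> ln (ln (real n))"
    "ln (ln (real n)) \<le> ln (real n) / (27 / 10)"
    "ln (real n) \<le> 11974 / 10000 + real n / 9"
    "(ln (real n))\<^sup>2 \<le> 549 / 1000 * real n"
proof -
  let ?L = "ln (real n)"
  have n: "9 \<le> real n" using assms by simp
  then have "ln 9 \<le> ?L" by simp
  then show L: "2196 / 1000 \<le> ?L" using ln_9_bounds by simp
  then have "ln (2196 / 1000) \<le> ln ?L" by simp
  moreover have "ln (2196 / 1000 :: real) = ln 2 + ln (1098 / 1000)"
    using ln_mult[of 2 "1098 / 1000 :: real"] by simp
  ultimately show "782 / 1000 \<le> ln ?L"
    using ln_2_lower ln_ge_one_minus_inverse[of "1098 / 1000"] by simp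
  show "ln ?L \<le> ?L / (27 / 10)"
    using L by (intro ln_le_divide_27_10) simp
  show "?L \<le> 11974 / 10000 + real n / 9"
    using ln_le_tangent[of 9 "real n"] ln_9_bounds n by simp
  have "?L = 2 * ln (sqrt (real n))" using n by (simp add: ln_sqrt)
  also have "\<dots> \<le> 2 * (sqrt (real n) / (27 / 10))"
    using n by (intro mult_left_mono ln_le_divide_27_10) auto
  finally have "?L\<^sup>2 \<le> (2 * (sqrt (real n) / (27 / 10)))\<^sup>2"
    using L by (intro power_mono) auto
  also have "\<dots> = 400 / 729 * real n" using n by (simp add: power_mult_distrib power_divide)
  also have "\<dots> \<le> 549 / 1000 * real n" using n by simp
  finally show "?L\<^sup>2 \<le> 549 / 1000 * real n" .
qed

section \<open>Powers with directed rounding\<close>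

text \<open>
  Numerical claims about \<^const>\<open>nu_star\<close> are inequalities between powers with exponents up to \<open>324\<close>. Exact
  rational powers would have thousands of digits; instead a natural number \<open>x\<close> represents \<open>x / 10 ^ 8\<close>, and
  repeated squaring with rounding after every multiplication keeps all numbers short.
\<close>

definition fixed_one :: nat where "fixed_one = 10 ^ 8"

text \<open>
  The rounding constant \<open>c\<close> is 0 for a lower and 1 for an upper bound of the product, since the
  division rounds down.
\<close>

definition fixed_mult :: "nat \<Rightarrow> nat \<Rightarrow> nat \<Rightarrow> nat" where
  "fixed_mult c x y = x * y div fixed_one + c"

definition fixed_square :: "nat \<Rightarrow> nat \<Rightarrow> nat" where
  "fixed_square c x = fixed_mult c x x"

fun fixed_power :: "nat \<Rightarrow> nat \<Rightarrow> nat \<Rightarrow> nat" where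
  "fixed_power c y m =
     (if m = 0 then fixed_one
      else if even m then fixed_square c (fixed_power c y (m div 2))
      else fixed_mult c (fixed_square c (fixed_power c y (m div 2))) y)"

declare fixed_power.simps [simp del]

definition fixed_value :: "nat \<Rightarrow> real" where
  "fixed_value x = real x / real fixed_one"

lemma fixed_value_nonneg [simp]: "0 \<le> fixed_value x"
  by (simp add: fixed_value_def)

lemma one_le_fixed_value:
  assumes "fixed_one \<le> y"
  shows "1 \<le> fixed_value y"
proof -
  have "real fixed_one \<le> real y" using assms by (simp only: of_nat_le_iff)
  moreover have "0 < real fixed_one" by (simp add: fixed_one_def)
  ultimately show ?thesis by (simp add: fixed_value_def le_divide_eq)
qed

lemma fixed_mult_lower: "fixed_value (fixed_mult 0 x y) \<le> fixed_value x * fixed_value y"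
proof -
  have "x * y div fixed_one * fixed_one \<le> x * y" by simp
  then have "real (x * y div fixed_one) * real fixed_one \<le> real x * real y"
    by (metis of_nat_le_iff of_nat_mult)
  moreover have "0 < real fixed_one" by (simp add: fixed_one_def)
  ultimately show ?thesis by (simp add: fixed_value_def fixed_mult_def field_simps)
qed

lemma fixed_mult_upper: "fixed_value x * fixed_value y \<le> fixed_value (fixed_mult 1 x y)"
proof -
  have one: "0 < fixed_one" by (simp add: fixed_one_def)
  then have "x * y \<le> (x * y div fixed_one + 1) * fixed_one"
    using dividend_less_div_times[of fixed_one "x * y"] by simp
  then have "real x * real y \<le> real (x * y div fixed_one + 1) * real fixed_one"
    by (metis of_nat_le_iff of_nat_mult)
  then show ?thesis using one by (simp add: fixed_value_def fixed_mult_def field_simps)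
qed

lemma power_split_half:
  fixes x :: "'a::monoid_mult"
  shows "x ^ m = (if even m then x ^ (m div 2) * x ^ (m div 2) else x ^ (m div 2) * x ^ (m div 2) * x)"
proof -
  have "x ^ m = x ^ (m div 2 + m div 2 + m mod 2)"
    by (rule arg_cong[of _ _ "\<lambda>k. x ^ k"]) presburger
  also have "\<dots> = x ^ (m div 2) * x ^ (m div 2) * x ^ (m mod 2)"
    by (simp add: power_add)
  finally show ?thesis by (simp add: even_iff_mod_2_eq_zero odd_iff_mod_2_eq_one)
qed

lemma fixed_power_lower: "fixed_value (fixed_power 0 y m) \<le> fixed_value y ^ m"
proof (induction m rule: less_induct)
  case (less m)
  show ?case
  proof (cases "m = 0")
    case True
    then show ?thesis by (simp add: fixed_power.simps fixed_value_def fixed_one_def)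
  next
    case False
    define r where "r = fixed_power 0 y (m div 2)"
    define q where "q = fixed_square 0 r"
    have "fixed_value q \<le> fixed_value r * fixed_value r"
      unfolding q_def fixed_square_def by (rule fixed_mult_lower)
    also have "\<dots> \<le> fixed_value y ^ (m div 2) * fixed_value y ^ (m div 2)"
      using less[of "m div 2"] False by (intro mult_mono) (auto simp: r_def)
    finally have q: "fixed_value q \<le> fixed_value y ^ (m div 2) * fixed_value y ^ (m div 2)" .
    have "fixed_power 0 y m = (if even m then q else fixed_mult 0 q y)"
      using False by (subst fixed_power.simps) (simp only: q_def r_def if_False)
    moreover have "fixed_value (fixed_mult 0 q y)
        \<le> fixed_value y ^ (m div 2) * fixed_value y ^ (m div 2) * fixed_value y"
      using fixed_mult_lower[of q y] mult_right_mono[OF q, of "fixed_value y"] by simp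
    ultimately show ?thesis
      using q by (simp add: power_split_half[of "fixed_value y" m])
  qed
qed

lemma fixed_power_upper: "fixed_value y ^ m \<le> fixed_value (fixed_power 1 y m)"
proof (induction m rule: less_induct)
  case (less m)
  show ?case
  proof (cases "m = 0")
    case True
    then show ?thesis by (simp add: fixed_power.simps fixed_value_def fixed_one_def)
  next
    case False
    define r where "r = fixed_power 1 y (m div 2)"
    define q where "q = fixed_square 1 r"
    have "fixed_value y ^ (m div 2) * fixed_value y ^ (m div 2) \<le> fixed_value r * fixed_value r"
      using less[of "m div 2"] False by (intro mult_mono) (auto simp: r_def)
    also have "\<dots> \<le> fixed_value q"
      unfolding q_def fixed_square_def by (rule fixed_mult_upper)
    finally have q: "fixed_value y ^ (m div 2) * fixed_value y ^ (m div 2) \<le> fixed_value q" .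
    have "fixed_power 1 y m = (if even m then q else fixed_mult 1 q y)"
      using False by (subst fixed_power.simps) (simp only: q_def r_def if_False)
    moreover have "fixed_value y ^ (m div 2) * fixed_value y ^ (m div 2) * fixed_value y
        \<le> fixed_value (fixed_mult 1 q y)"
      using fixed_mult_upper[of q y] mult_right_mono[OF q, of "fixed_value y"] by simp
    ultimately show ?thesis
      using q by (simp add: power_split_half[of "fixed_value y" m])
  qed
qed

text \<open>
  The premise with \<open>n * fixed_one\<close> makes the bracket of \<^const>\<open>boundary_fun\<close> nonnegative, so that truncated
  subtraction is exact and the rounded factors may be multiplied.
\<close>

lemma nu_star_less_fixedI:
  assumes n: "2 \<le> n" and y: "fixed_one \<le> y"
    and b: "n * fixed_one \<le> (n - 1) * fixed_power 0 y (2 * n - 1)"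
    and f: "(2 * n - 1) * fixed_one\<^sup>2
      < fixed_power 0 y ((n - 1)^2) * ((n - 1) * fixed_power 0 y (2 * n - 1) - n * fixed_one)"
  shows "nu_star n < fixed_value y"
proof -
  define p q where "p = fixed_power 0 y ((n - 1)^2)" and "q = fixed_power 0 y (2 * n - 1)"
  have one: "0 < real fixed_one" by (simp add: fixed_one_def)
  have "real ((2 * n - 1) * fixed_one\<^sup>2) < real (p * ((n - 1) * q - n * fixed_one))"
    using f unfolding p_def q_def of_nat_less_iff .
  then have "(2 * real n - 1) * real fixed_one ^ 2 < real p * ((real n - 1) * real q - real n * real fixed_one)"
    using n b by (simp add: of_nat_diff q_def)
  then have "2 * real n - 1 < fixed_value p * ((real n - 1) * fixed_value q - real n)"
    using one by (simp add: fixed_value_def field_simps power2_eq_square)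
  also have "\<dots> \<le> boundary_fun n (fixed_value y)"
  proof -
    have "real (n * fixed_one) \<le> real ((n - 1) * q)"
      using b unfolding q_def of_nat_le_iff .
    moreover have "real (n - 1) = real n - 1" using n by simp
    ultimately have "real n * real fixed_one \<le> (real n - 1) * real q"
      by (simp only: of_nat_mult)
    then have "0 \<le> (real n - 1) * fixed_value q - real n"
      using one by (simp add: fixed_value_def field_simps)
    moreover have "(real n - 1) * fixed_value q \<le> (real n - 1) * fixed_value y ^ (2 * n - 1)"
      unfolding q_def using n by (intro mult_left_mono fixed_power_lower) auto
    moreover have "fixed_value p \<le> fixed_value y ^ ((n - 1)^2)"
      unfolding p_def by (rule fixed_power_lower)
    ultimately show ?thesis
      unfolding boundary_fun_def by (intro mult_mono) auto
  qed
  finally show ?thesis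
    using nu_star_less_iff[OF n one_le_fixed_value[OF y]] by blast
qed

lemma less_nu_star_fixedI:
  assumes n: "2 \<le> n" and y: "fixed_one \<le> y"
    and b: "n * fixed_one \<le> (n - 1) * fixed_power 1 y (2 * n - 1)"
    and f: "fixed_power 1 y ((n - 1)^2) * ((n - 1) * fixed_power 1 y (2 * n - 1) - n * fixed_one)
      < (2 * n - 1) * fixed_one\<^sup>2"
  shows "fixed_value y < nu_star n"
proof -
  define p q where "p = fixed_power 1 y ((n - 1)^2)" and "q = fixed_power 1 y (2 * n - 1)"
  have one: "0 < real fixed_one" by (simp add: fixed_one_def)
  have "boundary_fun n (fixed_value y) \<le> fixed_value p * ((real n - 1) * fixed_value q - real n)"
  proof -
    have "real (n * fixed_one) \<le> real ((n - 1) * q)"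
      using b unfolding q_def of_nat_le_iff .
    moreover have "real (n - 1) = real n - 1" using n by simp
    ultimately have "real n * real fixed_one \<le> (real n - 1) * real q"
      by (simp only: of_nat_mult)
    then have R: "0 \<le> (real n - 1) * fixed_value q - real n"
      using one by (simp add: fixed_value_def field_simps)
    have "(real n - 1) * fixed_value y ^ (2 * n - 1) \<le> (real n - 1) * fixed_value q"
      unfolding q_def using n by (intro mult_left_mono fixed_power_upper) auto
    then have "boundary_fun n (fixed_value y)
        \<le> fixed_value y ^ ((n - 1)^2) * ((real n - 1) * fixed_value q - real n)"
      unfolding boundary_fun_def by (intro mult_left_mono) auto
    also have "\<dots> \<le> fixed_value p * ((real n - 1) * fixed_value q - real n)"
      unfolding p_def using R by (intro mult_right_mono fixed_power_upper) auto
    finally show ?thesis .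
  qed
  also have "\<dots> < 2 * real n - 1"
  proof -
    have "real (p * ((n - 1) * q - n * fixed_one)) < real ((2 * n - 1) * fixed_one\<^sup>2)"
      using f unfolding p_def q_def of_nat_less_iff .
    then have "real p * ((real n - 1) * real q - real n * real fixed_one) < (2 * real n - 1) * real fixed_one ^ 2"
      using n b by (simp add: of_nat_diff q_def)
    then show ?thesis
      using one by (simp add: fixed_value_def field_simps power2_eq_square)
  qed
  finally show ?thesis
    using less_nu_star_iff[OF n one_le_fixed_value[OF y]] by blast
qed

lemma ceiling_thousandth:
  fixes x :: real
  assumes "real v - 1 < 1000 * x" "1000 * x \<le> real v"
  shows "rounded_up 3 x = real v / 1000"
proof -
  have "\<lceil>1000 * x\<rceil> = int v"
    by (rule ceiling_unique) (use assms in \<open>simp_all only: of_int_of_nat_eq\<close>)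
  moreover have "rounded_up 3 x = real_of_int \<lceil>1000 * x\<rceil> / 1000"
    unfolding rounded_up_def by simp
  ultimately show ?thesis by simp
qed

lemma rounded_up_amplificationI:
  assumes n: "2 \<le> n"
    and lo: "fixed_value lo < nu_star n" "(v - 1) * fixed_one < 1000 * fixed_power 0 lo ((n^2 - n) div 2)"
    and hi: "nu_star n < fixed_value hi" "1000 * fixed_power 1 hi ((n^2 - n) div 2) \<le> v * fixed_one"
  shows "rounded_up 3 (real_of_ereal (ssp3_amplification n)) = real v / 1000"
proof -
  define A where "A = (n^2 - n) div 2"
  define p q where "p = fixed_power 0 lo A" and "q = fixed_power 1 hi A"
  have one: "0 < real fixed_one" by (simp add: fixed_one_def)
  have \<nu>: "1 \<le> nu_star n" using nu_star_root[OF n] by simp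
  have "real ((v - 1) * fixed_one) < real (1000 * p)"
    using lo(2) unfolding p_def A_def of_nat_less_iff .
  then have "real (v - 1) < 1000 * fixed_value p"
    using one by (simp add: fixed_value_def field_simps)
  also have "\<dots> \<le> 1000 * fixed_value lo ^ A"
    by (simp add: p_def fixed_power_lower)
  also have "\<dots> \<le> 1000 * nu_star n ^ A"
    using lo(1) by (intro mult_left_mono power_mono) auto
  finally have 1: "real v - 1 < 1000 * nu_star n ^ A" by linarith
  have "1000 * nu_star n ^ A \<le> 1000 * fixed_value hi ^ A"
    using hi(1) \<nu> by (intro mult_left_mono power_mono) auto
  also have "\<dots> \<le> 1000 * fixed_value q"
    unfolding q_def by (intro mult_left_mono fixed_power_upper) auto
  also have "\<dots> \<le> real v"
  proof -
    have "real (1000 * q) \<le> real (v * fixed_one)"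
      using hi(2) unfolding q_def A_def of_nat_le_iff .
    then have "1000 * real q \<le> real v * real fixed_one"
      unfolding of_nat_mult of_nat_numeral .
    then show ?thesis
      unfolding fixed_value_def times_divide_eq_right pos_divide_le_eq[OF one] .
  qed
  finally have "rounded_up 3 (nu_star n ^ A) = real v / 1000"
    by (rule ceiling_thousandth[OF 1])
  then show ?thesis
    unfolding ssp3_amplification_eq[OF n] A_def real_of_ereal.simps .
qed

lemmas fixed_eval = fixed_power.simps fixed_square_def fixed_mult_def fixed_one_def[simplified]

section \<open>Asymptotic bounds\<close>

lemma exp_ln_diff_ln_ln:
  assumes "9 \<le> n"
  shows "exp (ln (real n) - ln (ln (real n))) = real n / ln (real n)"
  using ln_nat_bounds(1)[OF assms] assms by (simp add: exp_diff)

lemma real_half_exponent: "real ((n^2 - n) div 2) = (real n ^ 2 - real n) / 2"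
proof -
  have "even (n^2 - n)" by simp
  moreover have "n \<le> n^2" by (simp add: power2_eq_square)
  ultimately show ?thesis by (simp add: real_of_nat_div of_nat_diff)
qed

lemma half_exponent_pos:
  fixes n :: nat
  assumes "2 \<le> n"
  shows "0 < (n^2 - n) div 2"
proof -
  have "2 * n \<le> n * n" using assms by (rule mult_le_mono1)
  then have "2 \<le> n^2 - n" using assms unfolding power2_eq_square by linarith
  then show ?thesis by (simp add: div_greater_zero_iff)
qed

text \<open>
  With \<open>D = ln n - ln (ln n)\<close> the left side is \<open>0.9 exp (D / 2)\<close>, while \<open>ln (1 + u) \<ge> u - u\<^sup>2\<close> for \<open>u = D / n\<^sup>2\<close>
  bounds the logarithm of the power from below by \<open>D / 2 - D / (2 n) - D\<^sup>2 / (2 n\<^sup>2)\<close>. The loss is largest at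
  \<open>n = 9\<close> and stays below \<open>0.0913\<close>, whereas \<open>0.9 < 1 - 0.0913\<close>.
\<close>

lemma lower_bound_gt_sqrt:
  assumes n: "9 \<le> n"
  shows "9 / 10 * sqrt (real n / ln (real n))
    < (1 + ln (real n) / real n ^ 2 - ln (ln (real n)) / real n ^ 2) ^ ((n^2 - n) div 2)"
proof -
  define N where "N = real n"
  define D where "D = ln N - ln (ln N)"
  define u where "u = D / N\<^sup>2"
  let ?A = "(n^2 - n) div 2"
  note b = ln_nat_bounds[OF n, folded N_def]
  have N: "9 \<le> N" using n by (simp add: N_def)
  have D: "1 \<le> D" using b unfolding D_def by simp
  \<comment> \<open>\<open>D\<close> is at most \<open>n / 9 + 1.1974 - 0.782\<close>, and \<open>n \<ge> 9\<close>.\<close>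
  have DN: "D / N \<le> 1576 / 10000"
    using b N unfolding D_def by (simp add: field_simps)
  have u0: "0 < u" using D N by (simp add: u_def)
  have "u = D / N / N" by (simp add: u_def power2_eq_square)
  also have "\<dots> \<le> D / N" using N D by (simp add: field_simps)
  finally have u1: "u \<le> 1" using DN by linarith
  have "D / 2 - 913 / 10000 \<le> D / 2 - D / N / 2 - (D / N)\<^sup>2 / 2"
  proof -
    have "(D / N)\<^sup>2 \<le> (1576 / 10000)\<^sup>2" using DN D N by (intro power_mono) auto
    then show ?thesis using DN by (simp add: power2_eq_square)
  qed
  also have "\<dots> = (N\<^sup>2 - N) / 2 * u - N\<^sup>2 / 2 * u\<^sup>2"
    using N by (simp add: u_def field_simps power2_eq_square)
  also have "\<dots> \<le> (N\<^sup>2 - N) / 2 * (u - u\<^sup>2)"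
    using N by (simp add: right_diff_distrib left_diff_distrib diff_divide_distrib)
  also have "\<dots> \<le> (N\<^sup>2 - N) / 2 * ln (1 + u)"
    using N u0 u1 by (intro mult_left_mono ln_one_plus_pos_lower_bound) (auto simp: power2_eq_square)
  also have "\<dots> = ln ((1 + u) ^ ?A)"
    using u0 by (simp add: ln_realpow real_half_exponent N_def)
  finally have "exp (D / 2 - 913 / 10000) \<le> (1 + u) ^ ?A"
    using u0 by (simp add: ln_ge_iff)
  moreover have "exp (D / 2) = sqrt (N / ln N)"
  proof -
    have "sqrt (exp D) = exp (D / 2)"
      using real_sqrt_abs2[of "exp (D / 2)"] by (simp flip: exp_add)
    then show ?thesis
      using exp_ln_diff_ln_ln[OF n, folded N_def] by (simp add: D_def)
  qed
  moreover have "exp (D / 2) * (1 - 913 / 10000) \<le> exp (D / 2 - 913 / 10000)"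
    by (rule exp_diff_lower)
  moreover have "9 / 10 * exp (D / 2) < exp (D / 2) * (1 - 913 / 10000)" by simp
  ultimately have "9 / 10 * sqrt (N / ln N) < (1 + u) ^ ?A" by linarith
  moreover have "1 + u = 1 + ln N / N\<^sup>2 - ln (ln N) / N\<^sup>2"
    by (simp add: u_def D_def diff_divide_distrib)
  ultimately show ?thesis unfolding N_def by simp
qed

text \<open>
  Let \<open>L = ln n\<close>, \<open>D = L - ln L\<close> and \<open>x = 1 + D / n\<^sup>2\<close>. Then \<open>x ^ (n - 1)\<^sup>2 \<le> exp D = n / L\<close>, and expanding
  \<open>x ^ (2 n - 1) \<le> exp t\<close> with \<open>t\<close> about \<open>2 D / n\<close> to second order bounds the bracket of \<^const>\<open>boundary_fun\<close> by
  \<open>2 D - 1 + 4 D\<^sup>2 / n\<close>. The product is about \<open>2 n - (2 ln L + 1) n / L\<close>, which is below \<open>2 n - 1\<close> because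
  \<open>4 D\<^sup>2 + L\<close> is small compared with \<open>n (1 + 2 ln L)\<close>.
\<close>

lemma lower_bound_less_nu_star:
  assumes n: "9 \<le> n"
  shows "1 \<le> 1 + ln (real n) / real n ^ 2 - ln (ln (real n)) / real n ^ 2"
    and "1 + ln (real n) / real n ^ 2 - ln (ln (real n)) / real n ^ 2 < nu_star n"
proof -
  define N where "N = real n"
  define L where "L = ln N"
  define D where "D = L - ln L"
  define t where "t = (2 * N - 1) * (D / N\<^sup>2)"
  let ?x = "1 + D / N\<^sup>2"
  note b = ln_nat_bounds[OF n, folded N_def, folded L_def]
  have N: "9 \<le> N" using n by (simp add: N_def)
  have D: "1 \<le> D" "D \<le> L" using b unfolding D_def by simp_all
  have x: "1 \<le> ?x" using D by simp
  have rn: "real (2 * n - 1) = 2 * N - 1" using n by (simp add: N_def of_nat_diff)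
  have t0: "0 \<le> t" using N D by (simp add: t_def)
  have t2: "t \<le> 2 * D / N" using N D by (simp add: t_def field_simps power2_eq_square)
  also have "\<dots> \<le> 1" using b N D by (simp add: field_simps)
  finally have t1: "t \<le> 1" .
  have X: "?x ^ ((n - 1)^2) \<le> N / L"
  proof -
    have "?x ^ ((n - 1)^2) \<le> ?x ^ (n^2)"
      using x n by (intro power_increasing power_mono) auto
    also have "\<dots> \<le> exp (D / N\<^sup>2) ^ (n^2)"
      using x by (intro power_mono exp_ge_add_one_self) auto
    also have "\<dots> = exp D" using N by (simp flip: exp_of_nat_mult add: N_def)
    also have "\<dots> = N / L" using exp_ln_diff_ln_ln[OF n] by (simp add: D_def L_def N_def)
    finally show ?thesis .
  qed
  have "?x ^ (2 * n - 1) \<le> exp (D / N\<^sup>2) ^ (2 * n - 1)"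
    using x by (intro power_mono exp_ge_add_one_self) auto
  also have "\<dots> = exp t" by (simp only: t_def rn flip: exp_of_nat_mult)
  also have "\<dots> \<le> 1 + t + t\<^sup>2" using t0 t1 by (rule exp_bound)
  finally have "(N - 1) * ?x ^ (2 * n - 1) \<le> (N - 1) * (1 + t + t\<^sup>2)"
    using N by (intro mult_left_mono) auto
  also have "\<dots> \<le> N - 1 + N * t + N * t * t"
    using N t0 by (simp add: algebra_simps power2_eq_square)
  also have "\<dots> \<le> N - 1 + 2 * D + 2 * D * (2 * D / N)"
  proof -
    have "N * t \<le> 2 * D" using t2 N by (simp add: field_simps)
    moreover from this have "N * t * t \<le> 2 * D * (2 * D / N)"
      by (rule mult_mono) (use t2 t0 D in auto)
    ultimately show ?thesis by simp
  qed
  finally have R: "(N - 1) * ?x ^ (2 * n - 1) - N \<le> 2 * D + 4 * D\<^sup>2 / N - 1" (is "_ \<le> ?R")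
    by (simp add: power2_eq_square)
  have "0 \<le> 4 * D\<^sup>2 / N" using N by simp
  then have R0: "0 \<le> ?R" using D by linarith
  have "boundary_fun n ?x \<le> ?x ^ ((n - 1)^2) * ?R"
    unfolding boundary_fun_def using R x by (intro mult_left_mono) (auto simp: N_def)
  also have "\<dots> \<le> N / L * ?R"
    using X R0 by (intro mult_right_mono) auto
  also have "\<dots> < 2 * N - 1"
  proof -
    have "D\<^sup>2 \<le> L\<^sup>2" using D by (intro power_mono) auto
    then have "4 * D\<^sup>2 + L < N * (1 + 2 * ln L)"
    proof -
      have "N * (2564 / 1000) \<le> N * (1 + 2 * ln L)" using b N by (intro mult_left_mono) auto
      then show ?thesis using \<open>D\<^sup>2 \<le> L\<^sup>2\<close> b N by linarith
    qed
    then have "N * ?R < (2 * N - 1) * L"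
      using N by (simp add: D_def algebra_simps)
    then show ?thesis using b by (simp add: field_simps)
  qed
  finally have "?x < nu_star n" using x n by (simp add: less_nu_star_iff N_def)
  moreover have "?x = 1 + ln N / N\<^sup>2 - ln (ln N) / N\<^sup>2"
    by (simp add: D_def L_def diff_divide_distrib)
  ultimately show "1 \<le> 1 + ln (real n) / real n ^ 2 - ln (ln (real n)) / real n ^ 2"
    and "1 + ln (real n) / real n ^ 2 - ln (ln (real n)) / real n ^ 2 < nu_star n"
    using x by (simp_all add: N_def)
qed

text \<open>
  Let \<open>L = ln n\<close>, \<open>E = L - ln L / 8\<close> and \<open>u = E / n\<^sup>2\<close>. Now \<^const>\<open>boundary_fun\<close> at \<open>1 + u\<close> has to be bounded from below. Its
  power factor is at least \<open>exp E\<close> up to the factor \<open>exp (- 2 E / n - E\<^sup>2 / n\<^sup>2) > 0.6728\<close>, where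
  \<open>exp E = n / T\<close> with \<open>T = L powr (1 / 8)\<close>; its bracket is at least \<open>(2 n - 1) G\<close> by Bernoulli's inequality, with
  \<open>n G\<close> about \<open>E - 1 / 2\<close>. As \<open>T\<close> grows only like the eighth root of \<open>L\<close>, the product exceeds \<open>2 n - 1\<close>; with these
  constants this needs \<open>L\<close> above about \<open>2.52\<close>, and \<open>n \<ge> 20\<close> also keeps \<open>L / n\<close> small.
\<close>

lemma nu_star_less_upper_bound_large:
  assumes n: "20 \<le> n"
  shows "nu_star n < 1 + ln (real n) / real n ^ 2 - ln (ln (real n)) / (8 * real n ^ 2)"
proof -
  define N where "N = real n"
  define L where "L = ln N"
  define E where "E = L - ln L / 8"
  define u where "u = E / N\<^sup>2"
  define T where "T = exp (ln L / 8)"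
  note b = ln_nat_bounds[of n, folded N_def, folded L_def]
  have n9: "9 \<le> n" using n by simp
  have N: "20 \<le> N" using n by (simp add: N_def)
  have "ln 16 \<le> L" using N unfolding L_def by simp
  then have L: "2772 / 1000 \<le> L" using ln_16_lower by simp
  \<comment> \<open>The constant lies just below \<open>1 - 1 / (8 * 2.7)\<close>.\<close>
  have E: "9537 / 10000 * L \<le> E" "E \<le> L" using b(2,3)[OF n9] L unfolding E_def by simp_all
  have LN: "L / N \<le> 152 / 1000"
  proof -
    have "ln (27::real) = 3 * ln 3" using ln_realpow[of 3 3] by simp
    then have "L \<le> 22961 / 10000 + N / 27"
      using ln_le_tangent[of 27 N] ln_3_bounds N unfolding L_def by simp
    then show ?thesis using N by (simp add: field_simps)
  qed
  have "E / N \<le> L / N" using E N by (intro divide_right_mono) auto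
  then have EN: "E / N \<le> 152 / 1000" "0 \<le> E / N"
    using LN E L N by (linarith, simp)
  have u0: "0 \<le> u" using E L by (simp add: u_def)
  have u1: "u \<le> 1"
  proof -
    have "u = E / N / N" by (simp add: u_def power2_eq_square)
    also have "\<dots> \<le> E / N / 1" using EN N by (intro divide_left_mono) auto
    also have "\<dots> \<le> 1" using EN by linarith
    finally show ?thesis .
  qed
  have rn: "real (2 * n - 1) = 2 * N - 1" "real ((n - 1)^2) = (N - 1)\<^sup>2"
    using n by (simp_all add: N_def of_nat_diff)
  have X: "6728 / 10000 * (N / T) \<le> (1 + u) ^ ((n - 1)^2)"
  proof -
    define e where "e = E / N"
    have e: "0 \<le> e" "e \<le> 152 / 1000" using EN by (simp_all only: e_def)
    then have "e\<^sup>2 \<le> (152 / 1000)\<^sup>2" by (intro power_mono) auto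
    then have "E - 3272 / 10000 \<le> E - 2 * e - e\<^sup>2"
      using e by (simp add: power2_eq_square)
    also have "\<dots> = (N\<^sup>2 - 2 * N) * u - N\<^sup>2 * u\<^sup>2"
      using N by (simp add: u_def e_def field_simps power2_eq_square)
    also have "\<dots> \<le> (N - 1)\<^sup>2 * u - (N - 1)\<^sup>2 * u\<^sup>2"
    proof -
      have "(N\<^sup>2 - 2 * N) * u \<le> (N - 1)\<^sup>2 * u"
        using u0 by (intro mult_right_mono) (auto simp: power2_eq_square algebra_simps)
      moreover have "(N - 1)\<^sup>2 * u\<^sup>2 \<le> N\<^sup>2 * u\<^sup>2"
        using N by (intro mult_right_mono power_mono) auto
      ultimately show ?thesis by simp
    qed
    also have "\<dots> = (N - 1)\<^sup>2 * (u - u\<^sup>2)" by (simp add: right_diff_distrib)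
    also have "\<dots> \<le> (N - 1)\<^sup>2 * ln (1 + u)"
      using u0 u1 by (intro mult_left_mono ln_one_plus_pos_lower_bound) auto
    also have "\<dots> = ln ((1 + u) ^ ((n - 1)^2))"
      using u0 by (simp only: ln_realpow rn)
    finally have "exp (E - 3272 / 10000) \<le> (1 + u) ^ ((n - 1)^2)"
      using u0 by (simp add: ln_ge_iff)
    moreover have "exp E = N / T"
      using N by (simp add: E_def T_def L_def exp_diff)
    moreover have "exp E * (6728 / 10000) \<le> exp (E - 3272 / 10000)"
      using exp_diff_lower[of E "3272 / 10000"] by simp
    ultimately show ?thesis by (simp only: mult.commute)
  qed
  define k where "k = 2 * N - 1"
  define G where "G = (N - 1) * u - 1 / k"
  have k: "39 \<le> k" using N by (simp add: k_def)
  have "1 + (2 * N - 1) * u \<le> (1 + u) ^ (2 * n - 1)"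
    using Bernoulli_inequality[of u "2 * n - 1"] u0 unfolding rn by simp
  then have "(N - 1) * (1 + (2 * N - 1) * u) \<le> (N - 1) * (1 + u) ^ (2 * n - 1)"
    using N by (intro mult_left_mono) auto
  moreover have "k * G = k * ((N - 1) * u) - 1"
    using k by (simp add: G_def right_diff_distrib)
  then have "(2 * N - 1) * G = (N - 1) * (1 + (2 * N - 1) * u) - N"
    by (simp add: k_def algebra_simps)
  ultimately have Y: "(2 * N - 1) * G \<le> (N - 1) * (1 + u) ^ (2 * n - 1) - N" by simp
  have NG: "906 / 1000 * L - 513 / 1000 \<le> N * G"
  proof -
    have "N * ((N - 1) * u) = (1 - 1 / N) * E"
      using N by (simp add: u_def field_simps power2_eq_square)
    then have "N * G = (1 - 1 / N) * E - N / k"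
      by (simp add: G_def right_diff_distrib)
    moreover have "1 / N \<le> 1 / 20" using N by (intro divide_left_mono) auto
    then have "95 / 100 * E \<le> (1 - 1 / N) * E"
      using E L by (intro mult_right_mono) auto
    moreover have "N / k \<le> 513 / 1000"
      using N k by (subst pos_divide_le_eq) (auto simp: k_def)
    ultimately show ?thesis using E by simp
  qed
  have T: "0 < T" "T \<le> 1 + (L - 1) / 8"
  proof -
    show "0 < T" by (simp add: T_def)
    \<comment> \<open>The tangent of the eighth root at 1, in the form of Bernoulli's inequality.\<close>
    have "T ^ 8 = L" using L by (simp add: T_def flip: exp_of_nat_mult)
    also have "L = 1 + real 8 * ((L - 1) / 8)" by (simp add: field_simps)
    also have "\<dots> \<le> (1 + (L - 1) / 8) ^ 8"
      using L by (intro Bernoulli_inequality) simp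
    finally show "T \<le> 1 + (L - 1) / 8"
      using L \<open>0 < T\<close> by (subst (asm) power_mono_iff) auto
  qed
  have "T < 6728 / 10000 * (906 / 1000 * L - 513 / 1000)"
    using T(2) L by (simp add: field_simps)
  also have "\<dots> \<le> 6728 / 10000 * (N * G)"
    using NG by (intro mult_left_mono) auto
  finally have "T < 6728 / 10000 * (N * G)" .
  then have "1 < 6728 / 10000 * (N * G) / T" using T by simp
  then have "(2 * N - 1) * 1 < (2 * N - 1) * (6728 / 10000 * (N * G) / T)"
    using N by (intro mult_strict_left_mono) auto
  then have "2 * N - 1 < 6728 / 10000 * (N / T) * ((2 * N - 1) * G)"
    by (simp add: mult_ac)
  also have "\<dots> \<le> (1 + u) ^ ((n - 1)^2) * ((2 * N - 1) * G)"
  proof -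
    have "0 \<le> N * G" using NG L by linarith
    then have "0 \<le> G" using N by (simp add: zero_le_mult_iff)
    then show ?thesis using X N by (intro mult_right_mono) auto
  qed
  also have "\<dots> \<le> boundary_fun n (1 + u)"
    unfolding boundary_fun_def using Y u0 by (intro mult_left_mono) (auto simp: N_def)
  finally have "nu_star n < 1 + u"
    using u0 n by (simp add: nu_star_less_iff N_def)
  also have "1 + u = 1 + ln N / N\<^sup>2 - ln (ln N) / (8 * N\<^sup>2)"
    by (simp add: u_def E_def L_def diff_divide_distrib)
  finally show ?thesis by (simp add: N_def)
qed

lemma nu_star_less_upper_bound_small:
  assumes n: "9 \<le> n" and l: "l \<le> ln (real n)"
    and less: "nu_star n < 1 + 9537 / 10000 * l / real n ^ 2"
  shows "nu_star n < 1 + ln (real n) / real n ^ 2 - ln (ln (real n)) / (8 * real n ^ 2)"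
proof -
  let ?E = "ln (real n) - ln (ln (real n)) / 8"
  have "9537 / 10000 * l \<le> ?E" using ln_nat_bounds(1,3)[OF n] l by simp
  then have "1 + 9537 / 10000 * l / real n ^ 2 \<le> 1 + ?E / real n ^ 2"
    by (intro add_left_mono divide_right_mono) simp_all
  with less show ?thesis by (simp add: diff_divide_distrib)
qed

text \<open>
  For \<open>n < 20\<close> the crude constants above do not suffice: for \<open>n = 9\<close> the function \<^const>\<open>boundary_fun\<close> exceeds
  \<open>2 n - 1\<close> at the upper bound by less than two percent. These cases are decided numerically, at a point below
  \<open>1 + 0.9537 l / n\<^sup>2\<close> for a lower bound \<open>l\<close> of \<open>ln n\<close>; for several \<open>n\<close> the logarithm of a smaller number is
  good enough.
\<close>

lemma nu_star_upper_numeric: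
  shows
    "nu_star 9 < 1 + 9537 / 10000 * (2196 / 1000) / real 9 ^ 2"
    "nu_star 10 < 1 + 9537 / 10000 * (2296 / 1000) / real 10 ^ 2"
    "nu_star 11 < 1 + 9537 / 10000 * (2296 / 1000) / real 11 ^ 2"
    "nu_star 12 < 1 + 9537 / 10000 * (2484 / 1000) / real 12 ^ 2"
    "nu_star 13 < 1 + 9537 / 10000 * (2484 / 1000) / real 13 ^ 2"
    "nu_star 14 < 1 + 9537 / 10000 * (2484 / 1000) / real 14 ^ 2"
    "nu_star 15 < 1 + 9537 / 10000 * (2484 / 1000) / real 15 ^ 2"
    "nu_star 16 < 1 + 9537 / 10000 * (2772 / 1000) / real 16 ^ 2"
    "nu_star 17 < 1 + 9537 / 10000 * (2772 / 1000) / real 17 ^ 2"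
    "nu_star 18 < 1 + 9537 / 10000 * (2772 / 1000) / real 18 ^ 2"
    "nu_star 19 < 1 + 9537 / 10000 * (2772 / 1000) / real 19 ^ 2"
  subgoal by (rule order.strict_trans2[OF nu_star_less_fixedI[where y = 102580000]];
      simp add: fixed_eval fixed_value_def)
  subgoal by (rule order.strict_trans2[OF nu_star_less_fixedI[where y = 102180000]];
      simp add: fixed_eval fixed_value_def)
  subgoal by (rule order.strict_trans2[OF nu_star_less_fixedI[where y = 101800000]];
      simp add: fixed_eval fixed_value_def)
  subgoal by (rule order.strict_trans2[OF nu_star_less_fixedI[where y = 101640000]];
      simp add: fixed_eval fixed_value_def)
  subgoal by (rule order.strict_trans2[OF nu_star_less_fixedI[where y = 101400000]];
      simp add: fixed_eval fixed_value_def)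
  subgoal by (rule order.strict_trans2[OF nu_star_less_fixedI[where y = 101200000]];
      simp add: fixed_eval fixed_value_def)
  subgoal by (rule order.strict_trans2[OF nu_star_less_fixedI[where y = 101050000]];
      simp add: fixed_eval fixed_value_def)
  subgoal by (rule order.strict_trans2[OF nu_star_less_fixedI[where y = 101030000]];
      simp add: fixed_eval fixed_value_def)
  subgoal by (rule order.strict_trans2[OF nu_star_less_fixedI[where y = 100910000]];
      simp add: fixed_eval fixed_value_def)
  subgoal by (rule order.strict_trans2[OF nu_star_less_fixedI[where y = 100810000]];
      simp add: fixed_eval fixed_value_def)
  subgoal by (rule order.strict_trans2[OF nu_star_less_fixedI[where y = 100730000]];
      simp add: fixed_eval fixed_value_def)
  done

lemma nu_star_less_upper_bound:
  assumes n: "9 \<le> n"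
  shows "nu_star n < 1 + ln (real n) / real n ^ 2 - ln (ln (real n)) / (8 * real n ^ 2)"
proof -
  have mono: "l \<le> ln (real n)" if "l \<le> ln (real m)" "0 < m" "m \<le> n" for l m
  proof -
    have "ln (real m) \<le> ln (real n)" using that by simp
    then show ?thesis using that(1) by linarith
  qed
  have L9: "2196 / 1000 \<le> ln (real n)" by (rule ln_nat_bounds(1)[OF n])
  have L10: "2296 / 1000 \<le> ln (real n)" if "10 \<le> n"
    by (rule mono[of _ 10]) (use that ln_10_lower in simp_all)
  have L12: "2484 / 1000 \<le> ln (real n)" if "12 \<le> n"
    by (rule mono[of _ 12]) (use that ln_12_lower in simp_all)
  have L16: "2772 / 1000 \<le> ln (real n)" if "16 \<le> n"
    by (rule mono[of _ 16]) (use that ln_16_lower in simp_all)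
  note small = nu_star_less_upper_bound_small[OF n]
  have "20 \<le> n \<or> n = 9 \<or> n = 10 \<or> n = 11 \<or> n = 12 \<or> n = 13 \<or> n = 14
      \<or> n = 15 \<or> n = 16 \<or> n = 17 \<or> n = 18 \<or> n = 19"
    using n by arith
  then consider "20 \<le> n" | "n = 9" | "n = 10" | "n = 11" | "n = 12" | "n = 13" | "n = 14"
    | "n = 15" | "n = 16" | "n = 17" | "n = 18" | "n = 19"
    by blast
  then show ?thesis
  proof cases
    case 1
    then show ?thesis by (rule nu_star_less_upper_bound_large)
  next
    case 2
    show ?thesis
      by (rule small[OF L9]) (simp only: 2 nu_star_upper_numeric)
  next
    case 3
    show ?thesis
      by (rule small[OF L10]) (simp add: 3, simp only: 3 nu_star_upper_numeric)
  next
    case 4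
    show ?thesis
      by (rule small[OF L10]) (simp add: 4, simp only: 4 nu_star_upper_numeric)
  next
    case 5
    show ?thesis
      by (rule small[OF L12]) (simp add: 5, simp only: 5 nu_star_upper_numeric)
  next
    case 6
    show ?thesis
      by (rule small[OF L12]) (simp add: 6, simp only: 6 nu_star_upper_numeric)
  next
    case 7
    show ?thesis
      by (rule small[OF L12]) (simp add: 7, simp only: 7 nu_star_upper_numeric)
  next
    case 8
    show ?thesis
      by (rule small[OF L12]) (simp add: 8, simp only: 8 nu_star_upper_numeric)
  next
    case 9
    show ?thesis
      by (rule small[OF L16]) (simp add: 9, simp only: 9 nu_star_upper_numeric)
  next
    case 10
    show ?thesis
      by (rule small[OF L16]) (simp add: 10, simp only: 10 nu_star_upper_numeric)
  next
    case 11
    show ?thesis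
      by (rule small[OF L16]) (simp add: 11, simp only: 11 nu_star_upper_numeric)
  next
    case 12
    show ?thesis
      by (rule small[OF L16]) (simp add: 12, simp only: 12 nu_star_upper_numeric)
  qed
qed

text \<open>
  With \<open>E = ln n - ln (ln n) / 8\<close> and \<open>u = E / n\<^sup>2\<close> the right side is \<open>exp (E / 2)\<close>, and \<open>1 + u \<le> exp u\<close> already suffices because the exponent
  \<open>(n\<^sup>2 - n) / 2\<close> lies below \<open>n\<^sup>2 / 2\<close>.
\<close>

lemma upper_bound_less_sqrt:
  assumes n: "9 \<le> n"
  shows "(1 + ln (real n) / real n ^ 2 - ln (ln (real n)) / (8 * real n ^ 2)) ^ ((n^2 - n) div 2)
    < sqrt (real n) / root 16 (ln (real n))"
proof -
  define N where "N = real n"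
  define L where "L = ln N"
  define E where "E = L - ln L / 8"
  let ?A = "(n^2 - n) div 2"
  note b = ln_nat_bounds[OF n, folded N_def, folded L_def]
  have N: "9 \<le> N" using n by (simp add: N_def)
  have E: "0 < E" using b unfolding E_def by simp
  have "(1 + E / N\<^sup>2) ^ ?A \<le> exp (E / N\<^sup>2) ^ ?A"
    using E by (intro power_mono exp_ge_add_one_self) auto
  also have "\<dots> = exp (real ?A * (E / N\<^sup>2))" by (simp only: exp_of_nat_mult)
  also have "real ?A * (E / N\<^sup>2) = E / 2 - E / N / 2"
    unfolding real_half_exponent N_def[symmetric] using N by (simp add: field_simps power2_eq_square)
  also have "exp (E / 2 - E / N / 2) < exp (E / 2)" using E N by simp
  also have "\<dots> = exp (ln N / 2) / exp (ln L / 16)"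
    by (simp add: E_def L_def diff_divide_distrib flip: exp_diff)
  also have "exp (ln N / 2) = sqrt N"
    using N exp_ln[of "sqrt N"] by (simp add: ln_sqrt)
  also have "exp (ln L / 16) = root 16 L"
    using b exp_ln[of "root 16 L"] by (simp add: ln_root)
  finally show ?thesis
    by (simp add: E_def L_def N_def diff_divide_distrib add_diff_eq)
qed

section \<open>Numerical values\<close>

text \<open>
  The enclosures have width about \<open>4 / 10 ^ 7\<close>. The tightest entry is \<open>n = 6\<close>, where the amplification factor
  exceeds \<open>2.208\<close> by only about \<open>3 / 10 ^ 5\<close>.
\<close>

lemma nu_star_lower_table:
  shows
    "fixed_value 157474287 < nu_star 2"
    "fixed_value 121495971 < nu_star 3"
    "fixed_value 111825306 < nu_star 4"
    "fixed_value 107651162 < nu_star 5"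
    "fixed_value 105422563 < nu_star 6"
    "fixed_value 104075854 < nu_star 7"
    "fixed_value 103192665 < nu_star 8"
    "fixed_value 102578638 < nu_star 9"
    "fixed_value 102132595 < nu_star 10"
  by (rule less_nu_star_fixedI; simp add: fixed_eval)+

lemma nu_star_upper_table:
  shows
    "nu_star 2 < fixed_value 157474328"
    "nu_star 3 < fixed_value 121496012"
    "nu_star 4 < fixed_value 111825347"
    "nu_star 5 < fixed_value 107651203"
    "nu_star 6 < fixed_value 105422604"
    "nu_star 7 < fixed_value 104075895"
    "nu_star 8 < fixed_value 103192706"
    "nu_star 9 < fixed_value 102578679"
    "nu_star 10 < fixed_value 102132636"
  by (rule nu_star_less_fixedI; simp add: fixed_eval)+

lemma ssp3_amplification_table:
  shows
    "rounded_up 3 (real_of_ereal (ssp3_amplification 2)) = real 1575 / 1000"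
    "rounded_up 3 (real_of_ereal (ssp3_amplification 3)) = real 1794 / 1000"
    "rounded_up 3 (real_of_ereal (ssp3_amplification 4)) = real 1956 / 1000"
    "rounded_up 3 (real_of_ereal (ssp3_amplification 5)) = real 2091 / 1000"
    "rounded_up 3 (real_of_ereal (ssp3_amplification 6)) = real 2209 / 1000"
    "rounded_up 3 (real_of_ereal (ssp3_amplification 7)) = real 2314 / 1000"
    "rounded_up 3 (real_of_ereal (ssp3_amplification 8)) = real 2411 / 1000"
    "rounded_up 3 (real_of_ereal (ssp3_amplification 9)) = real 2501 / 1000"
    "rounded_up 3 (real_of_ereal (ssp3_amplification 10)) = real 2585 / 1000"
proof -
  show "rounded_up 3 (real_of_ereal (ssp3_amplification 2)) = real 1575 / 1000"
    by (rule rounded_up_amplificationI[OF _ nu_star_lower_table(1) _ nu_star_upper_table(1)];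
        simp add: fixed_eval)
  show "rounded_up 3 (real_of_ereal (ssp3_amplification 3)) = real 1794 / 1000"
    by (rule rounded_up_amplificationI[OF _ nu_star_lower_table(2) _ nu_star_upper_table(2)];
        simp add: fixed_eval)
  show "rounded_up 3 (real_of_ereal (ssp3_amplification 4)) = real 1956 / 1000"
    by (rule rounded_up_amplificationI[OF _ nu_star_lower_table(3) _ nu_star_upper_table(3)];
        simp add: fixed_eval)
  show "rounded_up 3 (real_of_ereal (ssp3_amplification 5)) = real 2091 / 1000"
    by (rule rounded_up_amplificationI[OF _ nu_star_lower_table(4) _ nu_star_upper_table(4)];
        simp add: fixed_eval)
  show "rounded_up 3 (real_of_ereal (ssp3_amplification 6)) = real 2209 / 1000"
    by (rule rounded_up_amplificationI[OF _ nu_star_lower_table(5) _ nu_star_upper_table(5)];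
        simp add: fixed_eval)
  show "rounded_up 3 (real_of_ereal (ssp3_amplification 7)) = real 2314 / 1000"
    by (rule rounded_up_amplificationI[OF _ nu_star_lower_table(6) _ nu_star_upper_table(6)];
        simp add: fixed_eval)
  show "rounded_up 3 (real_of_ereal (ssp3_amplification 8)) = real 2411 / 1000"
    by (rule rounded_up_amplificationI[OF _ nu_star_lower_table(7) _ nu_star_upper_table(7)];
        simp add: fixed_eval)
  show "rounded_up 3 (real_of_ereal (ssp3_amplification 9)) = real 2501 / 1000"
    by (rule rounded_up_amplificationI[OF _ nu_star_lower_table(8) _ nu_star_upper_table(8)];
        simp add: fixed_eval)
  show "rounded_up 3 (real_of_ereal (ssp3_amplification 10)) = real 2585 / 1000"
    by (rule rounded_up_amplificationI[OF _ nu_star_lower_table(9) _ nu_star_upper_table(9)];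
        simp add: fixed_eval)
qed

theorem theorem3p6:
  shows
    "(\<forall>n\<ge>2. (\<exists>!\<rho>. 1 \<le> \<rho> \<and> mu_minus n \<rho> = 0) \<and>
        ssp3_amplification n = ereal (nu_star n ^ ((n^2 - n) div 2))) \<and>
     (\<forall>n\<ge>9.
        9 / 10 * sqrt (real n / ln (real n))
          < (1 + ln (real n) / real n ^ 2 - ln (ln (real n)) / real n ^ 2) ^ ((n^2 - n) div 2) \<and>
        ereal ((1 + ln (real n) / real n ^ 2 - ln (ln (real n)) / real n ^ 2) ^ ((n^2 - n) div 2))
          < ssp3_amplification n \<and>
        ssp3_amplification n
          < ereal ((1 + ln (real n) / real n ^ 2 - ln (ln (real n)) / (8 * real n ^ 2)) ^ ((n^2 - n) div 2)) \<and>
        (1 + ln (real n) / real n ^ 2 - ln (ln (real n)) / (8 * real n ^ 2)) ^ ((n^2 - n) div 2)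
          < sqrt (real n) / root 16 (ln (real n))) \<and>
     rounded_up 3 (real_of_ereal (ssp3_amplification 2)) = 1.575 \<and>
     rounded_up 3 (real_of_ereal (ssp3_amplification 3)) = 1.794 \<and>
     rounded_up 3 (real_of_ereal (ssp3_amplification 4)) = 1.956 \<and>
     rounded_up 3 (real_of_ereal (ssp3_amplification 5)) = 2.091 \<and>
     rounded_up 3 (real_of_ereal (ssp3_amplification 6)) = 2.209 \<and>
     rounded_up 3 (real_of_ereal (ssp3_amplification 7)) = 2.314 \<and>
     rounded_up 3 (real_of_ereal (ssp3_amplification 8)) = 2.411 \<and>
     rounded_up 3 (real_of_ereal (ssp3_amplification 9)) = 2.501 \<and>
     rounded_up 3 (real_of_ereal (ssp3_amplification 10)) = 2.585"
proof (intro conjI allI impI)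
  fix n :: nat
  assume "2 \<le> n"
  then show "\<exists>!\<rho>. 1 \<le> \<rho> \<and> mu_minus n \<rho> = 0"
    and "ssp3_amplification n = ereal (nu_star n ^ ((n^2 - n) div 2))"
    by (rule ex1_boundary_fun_root, rule ssp3_amplification_eq)
next
  fix n :: nat
  assume n: "9 \<le> n"
  let ?x = "1 + ln (real n) / real n ^ 2 - ln (ln (real n)) / real n ^ 2"
  let ?y = "1 + ln (real n) / real n ^ 2 - ln (ln (real n)) / (8 * real n ^ 2)"
  let ?A = "(n^2 - n) div 2"
  show "9 / 10 * sqrt (real n / ln (real n)) < ?x ^ ?A"
    using n by (rule lower_bound_gt_sqrt)
  show "?y ^ ?A < sqrt (real n) / root 16 (ln (real n))"
    using n by (rule upper_bound_less_sqrt)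
  have n2: "2 \<le> n" using n by simp
  have A: "0 < ?A" using half_exponent_pos[OF n2] .
  have "?x ^ ?A < nu_star n ^ ?A"
    by (rule power_strict_mono[OF lower_bound_less_nu_star(2)[OF n] _ A])
       (rule order.trans[OF zero_le_one lower_bound_less_nu_star(1)[OF n]])
  then show "ereal (?x ^ ?A) < ssp3_amplification n"
    unfolding ssp3_amplification_eq[OF n2] less_ereal.simps .
  have "nu_star n ^ ?A < ?y ^ ?A"
    by (rule power_strict_mono[OF nu_star_less_upper_bound[OF n] _ A])
       (rule order.trans[OF zero_le_one nu_star_root(1)[OF n2]])
  then show "ssp3_amplification n < ereal (?y ^ ?A)"
    unfolding ssp3_amplification_eq[OF n2] less_ereal.simps .
qed (simp_all only: ssp3_amplification_table, simp_all)

end
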